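(* Consider the extended bifactor model with probit link and let $(A,\mathbf d,\Sigma_G)\in\mathfrak P$. If the model is identifiable at $(A,\mathbf d,\Sigma_G)$, then both of the following conditions hold: (E1N) $|\mathcal Q_g|\ge 2$ for all $g=1,\dots,G$, and $|\mathcal Q_g|\ge 3$ for every $g$ such that $\Sigma_G[g,-g]=\mathbf 0$; (E2N) $|\mathcal H_3|\ge 2$.
   Context: Probit extended bifactor model. Fix $G\ge 1$ and items $\{1,\dots,J\}$ with a fixed known partition into $G$ nonempty testlets $\mathcal B_1,\dots,\mathcal B_G$; $g_j$ is the testlet containing item $j$. Parameters: a real $J\times(1+G)$ loading matrix $A=[\mathbf a_0,\mathbf a_1,\dots,\mathbf a_G]$ with $\mathbf a_g[j]=0$ whenever $g\ge1$ and $g\ne g_j$ (the other entries are arbitrary reals, possibly zero); intercepts $\mathbf d\in\mathbb R^J$; a $G\times G$ symmetric positive definite matrix $\Sigma_G$ with all diagonal entries equal to 1. The observed responses $Y_1,\dots,Y_J\in\{0,1\}$ are conditionally independent given $\boldsymbol\eta=(\eta_0,\eta_1,\dots,\eta_G)^T\sim N(\mathbf 0,\Sigma)$, $\Sigma=\begin{pmatrix}1&\mathbf 0^T\\ \mathbf 0&\Sigma_G\end{pmatrix}$, with $$P(Y_j=1\mid\boldsymbol\eta)=\Phi\big(d_j+\mathbf a_0[j]\,\eta_0+\mathbf a_{g_j}[j]\,\eta_{g_j}\big),$$ where $\Phi$ is the standard normal distribution function. The parameter space $\mathfrak P$ is the set of all such $(A,\mathbf d,\Sigma_G)$ for which the first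 nonzero entry of every column of $A$ is positive (no requirement on a zero column). The model is identifiable at $(A,\mathbf d,\Sigma_G)\in\mathfrak P$ if every $(A',\mathbf d',\Sigma_G')\in\mathfrak P$ that defines the same (marginal) distribution of $(Y_1,\dots,Y_J)$ equals $(A,\mathbf d,\Sigma_G)$. Notation: $x[\mathcal B]$ is the subvector of $x$ with entries in $\mathcal B$; $\bar A_g=(\mathbf a_0[\mathcal B_g],\mathbf a_g[\mathcal B_g])$ is the $|\mathcal B_g|\times 2$ matrix of main and testlet loadings of testlet $g$; $\Sigma_G[g,-g]$ is the $g$-th row of $\Sigma_G$ with its $g$-th entry removed. - $\mathcal Q_g=\{j:\mathbf a_g[j]\ne 0\}$ for $g=1,\dots,G$. - $\mathcal H_3=\{g\in\{1,\dots,G\}:\bar A_g\text{ has column rank }2\}$. *)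

theory Defs
  imports "HOL-Probability.Probability"
begin

text \<open>
  Items are the elements of a finite linearly ordered type \<^typ>\<open>'j\<close> and testlets the elements of a
  finite type \<^typ>\<open>'g\<close>.  The latent factors are indexed by \<^typ>\<open>'g option\<close>: \<^term>\<open>None\<close> is the main
  factor and \<^term>\<open>Some g\<close> the factor of testlet \<^term>\<open>g\<close>.  The partition of the items is a map
  \<open>testlet :: 'j \<Rightarrow> 'g\<close> sending an item to its testlet; that all testlets are nonempty means
  \<open>surj testlet\<close>.
\<close>

type_synonym ('j, 'g) bifactor_params =
  "(real ^ ('g option) ^ 'j) \<times> (real ^ 'j) \<times> (real ^ 'g ^ 'g)"

definition posdef_matrix :: "real ^ 'n ^ 'n \<Rightarrow> bool" where
  "posdef_matrix S \<longleftrightarrow> transpose S = S \<and> (\<forall>x. x \<noteq> 0 \<longrightarrow> x \<bullet> (S *v x) > 0)"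

text \<open>The centred normal distribution, meant for symmetric positive definite \<^term>\<open>S\<close>.\<close>

definition mvnormal :: "real ^ 'n ^ 'n \<Rightarrow> (real ^ 'n) measure" where
  "mvnormal S = density lborel (\<lambda>x. ennreal
     (exp (- (x \<bullet> (matrix_inv S *v x)) / 2) / sqrt ((2 * pi) ^ CARD('n) * det S)))"

definition factor_cov :: "real ^ 'g::finite ^ 'g \<Rightarrow> real ^ ('g option) ^ ('g option)" where
  "factor_cov S = (\<chi> k l. case (k, l) of
       (None, None) \<Rightarrow> 1
     | (Some g, Some h) \<Rightarrow> S $ g $ h
     | _ \<Rightarrow> 0)"

definition param_space :: "('j::{finite,linorder} \<Rightarrow> 'g::finite) \<Rightarrow> ('j, 'g) bifactor_params set" where
  "param_space testlet = {(A, d, S).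
     (\<forall>j g. g \<noteq> testlet j \<longrightarrow> A $ j $ Some g = 0) \<and>
     posdef_matrix S \<and> (\<forall>g. S $ g $ g = 1) \<and>
     (\<forall>k j. A $ j $ k \<noteq> 0 \<and> (\<forall>i<j. A $ i $ k = 0) \<longrightarrow> A $ j $ k > 0)}"

definition item_prob ::
    "('j::finite \<Rightarrow> 'g::finite) \<Rightarrow> real ^ ('g option) ^ 'j \<Rightarrow> real ^ 'j \<Rightarrow> real ^ ('g option) \<Rightarrow> 'j \<Rightarrow> real" where
  "item_prob testlet A d \<eta> j = cdf std_normal_distribution
     (d $ j + A $ j $ None * \<eta> $ None + A $ j $ Some (testlet j) * \<eta> $ Some (testlet j))"

text \<open>
  The response vector is a function \<^typ>\<open>'j \<Rightarrow> bool\<close>, with \<^term>\<open>True\<close> for the response 1.  Given the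
  factors, its coordinates are independent, hence the product \<^const>\<open>Pi_pmf\<close> (whose default value is
  irrelevant because the index set is \<^term>\<open>UNIV\<close>).
\<close>

definition cond_response ::
    "('j::finite \<Rightarrow> 'g::finite) \<Rightarrow> real ^ ('g option) ^ 'j \<Rightarrow> real ^ 'j \<Rightarrow> real ^ ('g option) \<Rightarrow> ('j \<Rightarrow> bool) pmf" where
  "cond_response testlet A d \<eta> = Pi_pmf UNIV False (\<lambda>j. bernoulli_pmf (item_prob testlet A d \<eta> j))"

text \<open>The marginal law of the responses: the conditional law mixed over the normal factors.\<close>

definition response_dist ::
    "('j::finite \<Rightarrow> 'g::finite) \<Rightarrow> ('j, 'g) bifactor_params \<Rightarrow> ('j \<Rightarrow> bool) measure" where
  "response_dist testlet = (\<lambda>(A, d, S).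
     Giry_Monad.bind (mvnormal (factor_cov S)) (\<lambda>\<eta>. measure_pmf (cond_response testlet A d \<eta>)))"

lemma item_prob_bounds: "0 \<le> item_prob testlet A d \<eta> j" "item_prob testlet A d \<eta> j \<le> 1"
proof -
  interpret real_distribution std_normal_distribution by (rule real_dist_normal_dist)
  show "0 \<le> item_prob testlet A d \<eta> j" "item_prob testlet A d \<eta> j \<le> 1"
    by (simp_all add: item_prob_def cdf_nonneg cdf_bounded_prob)
qed

lemma pmf_cond_response:
  "pmf (cond_response testlet A d \<eta>) y =
     (\<Prod>j\<in>UNIV. if y j then item_prob testlet A d \<eta> j else 1 - item_prob testlet A d \<eta> j)"
  unfolding cond_response_def
  by (subst pmf_Pi') (auto intro!: prod.cong simp: item_prob_bounds)

lemma measurable_item_prob [measurable]: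
  fixes testlet :: "'j::finite \<Rightarrow> 'g::finite"
  shows "(\<lambda>\<eta>. item_prob testlet A d \<eta> j) \<in> borel_measurable borel"
proof -
  interpret real_distribution std_normal_distribution by (rule real_dist_normal_dist)
  have [measurable]: "cdf std_normal_distribution \<in> borel_measurable borel"
    by (intro borel_measurable_mono) (auto simp: mono_def cdf_nondecreasing)
  have [measurable]: "(\<lambda>\<eta>::real ^ ('g option). \<eta> $ k) \<in> borel_measurable borel" for k
    by (intro borel_measurable_continuous_onI continuous_intros)
  show ?thesis unfolding item_prob_def by measurable
qed

lemma measurable_cond_response:
  fixes testlet :: "'j::finite \<Rightarrow> 'g::finite"
  shows "(\<lambda>\<eta>. measure_pmf (cond_response testlet A d \<eta>))
     \<in> measurable (mvnormal S) (subprob_algebra (count_space UNIV))"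
proof (rule measurable_subprob_algebra)
  fix X :: "('j \<Rightarrow> bool) set"
  have "emeasure (measure_pmf (cond_response testlet A d \<eta>)) X =
      (\<Sum>y\<in>X. ennreal (pmf (cond_response testlet A d \<eta>) y))" for \<eta>
    by (simp add: emeasure_measure_pmf_finite)
  then show "(\<lambda>\<eta>. emeasure (measure_pmf (cond_response testlet A d \<eta>)) X) \<in> borel_measurable (mvnormal S)"
    by (simp add: pmf_cond_response mvnormal_def)
qed (auto intro: subprob_space_measure_pmf)

lemma emeasure_response_dist:
  "emeasure (response_dist testlet (A, d, S)) {y} =
     (\<integral>\<^sup>+ \<eta>. ennreal (\<Prod>j\<in>UNIV. if y j then item_prob testlet A d \<eta> j else 1 - item_prob testlet A d \<eta> j)
        \<partial>mvnormal (factor_cov S))"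
  unfolding response_dist_def split
  by (subst emeasure_bind[OF _ measurable_cond_response])
     (auto simp: mvnormal_def emeasure_pmf_single pmf_cond_response)

definition identifiable_at ::
    "('j::{finite,linorder} \<Rightarrow> 'g::finite) \<Rightarrow> ('j, 'g) bifactor_params \<Rightarrow> bool" where
  "identifiable_at testlet \<theta> \<longleftrightarrow>
     (\<forall>\<theta>'\<in>param_space testlet. response_dist testlet \<theta>' = response_dist testlet \<theta> \<longrightarrow> \<theta>' = \<theta>)"

definition Q_set :: "real ^ ('g::finite option) ^ 'j \<Rightarrow> 'g \<Rightarrow> 'j set" where
  "Q_set A g = {j. A $ j $ Some g \<noteq> 0}"

text \<open>
  The matrix \<open>(a\<^sub>0[B\<^sub>g], a\<^sub>g[B\<^sub>g])\<close>, with the rows outside the testlet filled with zeros instead of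
  removed; this does not change the rank.
\<close>

definition testlet_loadings ::
    "('j::finite \<Rightarrow> 'g::finite) \<Rightarrow> real ^ ('g option) ^ 'j \<Rightarrow> 'g \<Rightarrow> real ^ 2 ^ 'j" where
  "testlet_loadings testlet A g =
     (\<chi> j. if testlet j = g then vector [A $ j $ None, A $ j $ Some g] else 0)"

definition H3_set :: "('j::finite \<Rightarrow> 'g::finite) \<Rightarrow> real ^ ('g option) ^ 'j \<Rightarrow> 'g set" where
  "H3_set testlet A = {g. rank (testlet_loadings testlet A g) = 2}"

end

theory Submission
  imports Defs
begin

text \<open>
  Item \<open>j\<close> has response 1 if and only if a latent variable, the sum of the intercept, the loadings times the
  factors and standard normal noise, is nonnegative. The latent variables are jointly normal, and the
  signs do not change when each latent variable is divided by its standard deviation. So the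
  distribution of the responses depends only on the standardized intercepts and the latent
  correlations. This is made precise by \<open>response_dist_eqI\<close>, whose proof computes the joint latent
  density up to a constant by completing the square; the constant is determined by the total mass 1,
  for which the normalization of the multivariate normal density has to be checked.

  Whenever one of the conditions fails, there is a different parameter with the same latent correlations:

  \<^item> If at most one item loads on a testlet factor, its loading can be raised while the correlations of
    the factor with the other factors are lowered
    (\<open>not_identifiable_if_testlet_has_one_loading\<close>).

  \<^item> If exactly two items load on a testlet factor that is uncorrelated with the others, only the product
    of the two standardized loadings matters
    (\<open>not_identifiable_if_uncorrelated_testlet_has_two_loadings\<close>).

  \<^item> If main and testlet loadings are proportional in all testlets other than \<open>g\<^sub>0\<close>, then each of those
    testlets involves only one linear combination of factors, and nothing fixes the direction of the
    main factor in the plane that it spans with the factor of \<open>g\<^sub>0\<close>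
    (\<open>not_identifiable_if_proportional_outside_one_testlet\<close>).
\<close>

section \<open>Positive definite matrices\<close>

lemma inner_matrix_vector_eq_sum:
  fixes P :: "real ^ 'n ^ 'n"
  shows "x \<bullet> (P *v x) = (\<Sum>j\<in>UNIV. \<Sum>k\<in>UNIV. x $ j * P $ j $ k * x $ k)"
  by (simp add: inner_vec_def matrix_vector_mult_def sum_distrib_left mult.assoc)

lemma posdef_matrix_symmetric: "posdef_matrix P \<Longrightarrow> P $ j $ k = P $ k $ j"
  unfolding posdef_matrix_def transpose_def by (metis vec_lambda_beta)

lemma posdef_matrix_inner_pos: "posdef_matrix P \<Longrightarrow> x \<noteq> 0 \<Longrightarrow> 0 < x \<bullet> (P *v x)"
  by (simp add: posdef_matrix_def)

lemma posdef_matrix_inner_nonneg: "posdef_matrix P \<Longrightarrow> 0 \<le> x \<bullet> (P *v x)"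
  by (cases "x = 0") (auto simp: posdef_matrix_def less_imp_le)

lemma posdef_matrix_diag_pos:
  assumes "posdef_matrix P"
  shows "0 < P $ i $ i"
proof -
  have "axis i 1 \<bullet> (P *v axis i 1) = P $ i $ i"
    by (simp add: inner_axis' matrix_vector_mult_basis column_def)
  moreover have "axis i 1 \<noteq> (0 :: real ^ 'a)"
    by (simp add: axis_eq_0_iff)
  ultimately show ?thesis
    using posdef_matrix_inner_pos[OF assms] by metis
qed

lemma posdef_correlation_less_1:
  fixes S :: "real ^ 'g ^ 'g"
  assumes S: "posdef_matrix S" and diag: "\<And>g. S $ g $ g = 1" and gh: "g \<noteq> h"
  shows "(S $ g $ h)\<^sup>2 < 1"
proof -
  let ?r = "S $ g $ h"
  \<comment> \<open>The residual of variable \<open>h\<close> after regression on variable \<open>g\<close> has positive variance \<open>1 - ?r\<^sup>2\<close>.\<close>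
  let ?x = "axis h 1 - ?r *\<^sub>R axis g 1 :: real ^ 'g"
  have "?x $ h = 1"
    using gh by (simp add: axis_def)
  then have "?x \<noteq> 0"
    by (metis zero_index zero_neq_one)
  have "S *v ?x = column h S - ?r *\<^sub>R column g S"
    by (simp add: matrix_vector_mult_diff_distrib matrix_vector_mult_scaleR matrix_vector_mult_basis)
  then have "?x \<bullet> (S *v ?x) = 1 - ?r\<^sup>2"
    using posdef_matrix_symmetric[OF S, of h g]
    by (simp add: inner_diff_left inner_diff_right inner_axis' column_def diag power2_eq_square)
  with posdef_matrix_inner_pos[OF S \<open>?x \<noteq> 0\<close>] show ?thesis
    by simp
qed

lemma inner_congruence:
  fixes S :: "real ^ 'n ^ 'n" and M :: "real ^ 'n ^ 'm"
  shows "x \<bullet> ((M ** S ** transpose M) *v x) = (transpose M *v x) \<bullet> (S *v (transpose M *v x))"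
proof -
  have "(transpose M *v x) \<bullet> (S *v (transpose M *v x)) = x \<bullet> (M *v (S *v (transpose M *v x)))"
    by (simp only: transpose_matrix_vector dot_lmul_matrix)
  then show ?thesis
    by (simp only: matrix_vector_mul_assoc matrix_mul_assoc)
qed

text \<open>
  The quadratic form of the product at \<open>x\<close> is that of \<open>S\<close> at
  \<open>transpose M *v x\<close>. Covariance matrices of linearly independent combinations of factors
  arise in this way.
\<close>

lemma posdef_matrix_congruence:
  fixes S :: "real ^ 'n ^ 'n" and M :: "real ^ 'n ^ 'm"
  assumes S: "posdef_matrix S" and inj: "\<And>x. transpose M *v x = 0 \<Longrightarrow> x = 0"
  shows "posdef_matrix (M ** S ** transpose M)"
  unfolding posdef_matrix_def
proof safe
  show "transpose (M ** S ** transpose M) = M ** S ** transpose M"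
    using S by (simp add: posdef_matrix_def matrix_transpose_mul matrix_mul_assoc transpose_transpose)
next
  fix x :: "real ^ 'm" assume "x \<noteq> 0"
  then have "transpose M *v x \<noteq> 0"
    using inj by blast
  then show "0 < x \<bullet> ((M ** S ** transpose M) *v x)"
    unfolding inner_congruence by (rule posdef_matrix_inner_pos[OF S])
qed

lemma posdef_matrix_invertible:
  assumes "posdef_matrix S"
  shows "S ** matrix_inv S = mat 1" and "matrix_inv S ** S = mat 1"
proof -
  have "x = 0" if "S *v x = 0" for x
    using posdef_matrix_inner_pos[OF assms, of x] that by auto
  then have "\<exists>T. T ** S = mat 1"
    by (simp add: matrix_left_invertible_ker)
  then have "\<exists>T. S ** T = mat 1 \<and> T ** S = mat 1"
    by (metis matrix_left_right_inverse)
  then have "S ** matrix_inv S = mat 1 \<and> matrix_inv S ** S = mat 1"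
    unfolding matrix_inv_def by (rule someI_ex)
  then show "S ** matrix_inv S = mat 1" "matrix_inv S ** S = mat 1"
    by auto
qed

lemma posdef_matrix_mult_inv_vec:
  "posdef_matrix S \<Longrightarrow> S *v (matrix_inv S *v x) = x"
  "posdef_matrix S \<Longrightarrow> matrix_inv S *v (S *v x) = x"
  by (simp_all add: matrix_vector_mul_assoc posdef_matrix_invertible)

lemma posdef_matrix_inner_commute:
  "posdef_matrix S \<Longrightarrow> x \<bullet> (S *v y) = (S *v x) \<bullet> y"
  by (metis dot_lmul_matrix posdef_matrix_def transpose_matrix_vector)

lemma posdef_matrix_inv:
  assumes S: "posdef_matrix S"
  shows "posdef_matrix (matrix_inv S)"
  unfolding posdef_matrix_def
proof safe
  have "S ** transpose (matrix_inv S) = mat 1"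
    using S posdef_matrix_invertible(2)[OF S]
    by (metis matrix_transpose_mul posdef_matrix_def transpose_mat)
  then show "transpose (matrix_inv S) = matrix_inv S"
    using posdef_matrix_invertible(2)[OF S] by (metis matrix_mul_assoc matrix_mul_lid matrix_mul_rid)
next
  fix x :: "real ^ 'a" assume "x \<noteq> 0"
  then have "matrix_inv S *v x \<noteq> 0"
    using posdef_matrix_mult_inv_vec(1)[OF S, of x] by auto
  then have "0 < (matrix_inv S *v x) \<bullet> (S *v (matrix_inv S *v x))"
    by (rule posdef_matrix_inner_pos[OF S])
  then show "0 < x \<bullet> (matrix_inv S *v x)"
    by (simp add: posdef_matrix_mult_inv_vec[OF S] inner_commute)
qed

lemma posdef_matrix_marginal_cov:
  fixes A :: "real ^ 'n ^ 'j"
  assumes S: "posdef_matrix S"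
  shows "posdef_matrix (mat 1 + A ** S ** transpose A)"
  unfolding posdef_matrix_def
proof safe
  show "transpose (mat 1 + A ** S ** transpose A) = mat 1 + A ** S ** transpose A"
  proof -
    have "transpose (A ** S ** transpose A) = A ** S ** transpose A"
      using S by (simp add: posdef_matrix_def matrix_transpose_mul matrix_mul_assoc)
    then show ?thesis
      by (simp add: vec_eq_iff transpose_def mat_def)
  qed
next
  fix x :: "real ^ 'j" assume "x \<noteq> 0"
  have "x \<bullet> ((mat 1 + A ** S ** transpose A) *v x) = x \<bullet> x + (transpose A *v x) \<bullet> (S *v (transpose A *v x))"
    by (simp only: matrix_vector_mult_add_rdistrib inner_add_right inner_congruence matrix_vector_mul_lid)
  then show "0 < x \<bullet> ((mat 1 + A ** S ** transpose A) *v x)"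
    using posdef_matrix_inner_nonneg[OF S, of "transpose A *v x"] \<open>x \<noteq> 0\<close>
    by (simp add: add_pos_nonneg)
qed

lemma posdef_matrix_posterior_precision:
  fixes A :: "real ^ 'n ^ 'j"
  assumes S: "posdef_matrix S"
  shows "posdef_matrix (matrix_inv S + transpose A ** A)"
  unfolding posdef_matrix_def
proof safe
  show "transpose (matrix_inv S + transpose A ** A) = matrix_inv S + transpose A ** A"
  proof -
    have "transpose (transpose A ** A) = transpose A ** A" "transpose (matrix_inv S) = matrix_inv S"
      using posdef_matrix_inv[OF S] by (simp_all add: posdef_matrix_def matrix_transpose_mul)
    then show ?thesis
      by (simp add: vec_eq_iff transpose_def)
  qed
next
  fix x :: "real ^ 'n" assume "x \<noteq> 0"
  have "x \<bullet> ((matrix_inv S + transpose A ** A) *v x) = x \<bullet> (matrix_inv S *v x) + (A *v x) \<bullet> (A *v x)"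
    by (simp add: matrix_vector_mult_add_rdistrib inner_add_right matrix_vector_mul_assoc[symmetric])
      (metis dot_lmul_matrix inner_commute transpose_matrix_vector)
  then show "0 < x \<bullet> ((matrix_inv S + transpose A ** A) *v x)"
    using posdef_matrix_inner_pos[OF posdef_matrix_inv[OF S] \<open>x \<noteq> 0\<close>] by (simp add: add_pos_nonneg)
qed

text \<open>
  One step of symmetric Gaussian elimination. The eliminated coordinate keeps a unit diagonal entry,
  so that all steps take place in matrices of the same size and determinants can be compared directly.
\<close>

lemma schur_complement_congruence:
  fixes P :: "real ^ 'n ^ 'n" and i :: 'n
  assumes P: "posdef_matrix P"
  defines "P' \<equiv> (\<chi> j k. if j = i \<or> k = i then if j = k then 1 else 0
                        else P $ j $ k - P $ i $ j * P $ i $ k / P $ i $ i)"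
  shows "posdef_matrix P'" and "det P = P $ i $ i * det P'"
proof -
  let ?p = "P $ i $ i"
  define v :: "real ^ 'n" where "v = (\<chi> j. if j = i then 1 / sqrt ?p else - P $ i $ j / ?p)"
  \<comment> \<open>Conjugating by the identity with its column \<open>i\<close> replaced by \<open>v\<close> clears row and column \<open>i\<close>.\<close>
  define E where "E = ((\<chi> j k. if k = i then v $ j else mat 1 $ j $ k) :: real ^ 'n ^ 'n)"
  have p: "0 < ?p"
    by (rule posdef_matrix_diag_pos[OF P])
  have sym: "P $ j $ i = P $ i $ j" if "j \<noteq> i" for j
    by (rule posdef_matrix_symmetric[OF P])
  \<comment> \<open>The determinant of an identity matrix with one column replaced is an instance of Cramer's rule.\<close>
  have det_E: "det E = 1 / sqrt ?p"
    using cramer_lemma[of i "mat 1" v] unfolding E_def matrix_vector_mul_lid by (simp add: v_def)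
  have E_entry: "E $ j $ a = (if a = j then if j = i then 0 else 1 else 0) + (if a = i then v $ j else 0)" for j a
    by (auto simp: E_def mat_def)
  have v_i: "v $ i = 1 / sqrt ?p"
    by (simp add: v_def)
  have v_j: "v $ j = - P $ i $ j / ?p" if "j \<noteq> i" for j
    using that by (simp add: v_def)
  have "(E ** P) $ j $ b = (if j = i then 0 else P $ j $ b) + v $ j * P $ i $ b" for j b
    by (simp add: matrix_matrix_mult_def E_entry distrib_right sum.distrib if_distrib[where f = "\<lambda>x. x * _"]
        sum.delta cong: if_cong)
  then have EP: "(E ** P) $ j $ b = (if j = i then P $ i $ b / sqrt ?p else P $ j $ b - P $ i $ j * P $ i $ b / ?p)" for j b
    by (cases "j = i") (simp_all add: v_i v_j)
  have "(E ** P ** transpose E) $ j $ k = (if k = i then 0 else (E ** P) $ j $ k) + (E ** P) $ j $ i * v $ k" for j k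
    unfolding matrix_matrix_mult_def[of "E ** P"] transpose_def
    by (simp add: E_entry distrib_left sum.distrib if_distrib[where f = "\<lambda>x. _ * x"]
        sum.delta cong: if_cong)
  moreover have "(E ** P) $ j $ i = (if j = i then sqrt ?p else 0)" for j
    unfolding EP using p by (simp add: sym real_div_sqrt)
  ultimately have entry: "(E ** P ** transpose E) $ j $ k =
      (if k = i then 0 else (E ** P) $ j $ k) + (if j = i then sqrt ?p else 0) * v $ k" for j k
    by simp
  have "(E ** P ** transpose E) $ j $ k = P' $ j $ k" for j k
  proof (cases "j = i")
    case True
    have "sqrt ?p * (P $ i $ k / ?p) = P $ i $ k / sqrt ?p"
    proof -
      have "sqrt ?p * (P $ i $ k / ?p) = (?p / sqrt ?p) * (P $ i $ k / ?p)"
        using p by (simp only: real_div_sqrt less_imp_le)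
      then show ?thesis
        using p by simp
    qed
    then show ?thesis
      using True p unfolding entry EP P'_def by (cases "k = i") (simp_all add: v_i v_j)
  next
    case False
    then show ?thesis
      unfolding entry EP P'_def by simp
  qed
  then have P'_eq: "E ** P ** transpose E = P'"
    by (simp add: vec_eq_iff)
  have inj: "x = 0" if "transpose E *v x = 0" for x
  proof -
    have *: "(\<Sum>j\<in>UNIV. E $ j $ k * x $ j) = 0" for k
      using that by (simp add: vec_eq_iff matrix_vector_mult_def transpose_def)
    have nz: "x $ k = 0" if "k \<noteq> i" for k
      using *[of k] that
      by (simp add: E_def mat_def if_distrib[where f = "\<lambda>x. x * _"] sum.delta cong: if_cong)
    have "(\<Sum>j\<in>UNIV. E $ j $ i * x $ j) = (\<Sum>j\<in>{i}. E $ j $ i * x $ j)"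
      by (rule sum.mono_neutral_right) (auto simp: nz)
    then have "x $ i = 0"
      using *[of i] p by (simp add: E_def v_def)
    with nz show ?thesis
      by (metis vec_eq_iff zero_index)
  qed
  have "posdef_matrix (E ** P ** transpose E)"
    by (rule posdef_matrix_congruence[OF P]) (rule inj)
  then show "posdef_matrix P'"
    by (simp only: P'_eq)
  have "det P' = (1 / sqrt ?p) * det P * (1 / sqrt ?p)"
    unfolding P'_eq[symmetric] det_mul det_transpose det_E by simp
  then show "det P = P $ i $ i * det P'"
    using p by (simp add: field_simps)
qed

section \<open>Gaussian integrals\<close>

lemma nn_integral_exp_shifted_square:
  fixes p m :: real
  assumes "0 < p"
  shows "(\<integral>\<^sup>+ y. ennreal (exp (- (p * (y + m)\<^sup>2) / 2)) \<partial>lborel) = ennreal (sqrt (2 * pi / p))"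
proof -
  let ?D = "normal_density (- m) (1 / sqrt p)"
  have "exp (- (p * (y + m)\<^sup>2) / 2) = sqrt (2 * pi / p) * ?D y" for y
    using assms by (simp add: normal_density_def power_divide field_simps)
  moreover have "(\<integral>\<^sup>+ y. ennreal (?D y) \<partial>lborel) = 1"
    using assms by (subst nn_integral_eq_integral) auto
  ultimately show ?thesis
    using assms by (simp add: ennreal_mult' nn_integral_cmult)
qed

lemma ennreal_exp_neg_half_add:
  "ennreal (exp (- (a + q) / 2)) = ennreal (exp (- a / 2)) * ennreal (exp (- q / 2))" for a q :: real
proof -
  have "- (a + q) / 2 = - a / 2 + - q / 2"
    by (simp add: field_simps)
  then show ?thesis
    by (simp only: exp_add ennreal_mult' exp_ge_zero)
qed

text \<open>
  The matrix of the remaining quadratic form is the Schur complement.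
\<close>

lemma complete_square_in_one_coordinate:
  fixes P :: "'n \<Rightarrow> 'n \<Rightarrow> real"
  assumes I: "finite I" "i \<notin> I" and sym: "\<And>j k. P j k = P k j" and p: "P i i \<noteq> 0"
  shows "(\<Sum>j\<in>insert i I. \<Sum>k\<in>insert i I. x j * P j k * x k) =
     P i i * (x i + (\<Sum>k\<in>I. P i k * x k) / P i i)\<^sup>2 + (\<Sum>j\<in>I. \<Sum>k\<in>I. x j * (P j k - P i j * P i k / P i i) * x k)"
proof -
  let ?b = "\<Sum>k\<in>I. P i k * x k"
  have "(\<Sum>j\<in>insert i I. \<Sum>k\<in>insert i I. x j * P j k * x k) =
      x i * P i i * x i + (\<Sum>k\<in>I. x i * P i k * x k) + (\<Sum>j\<in>I. x j * P j i * x i) + (\<Sum>j\<in>I. \<Sum>k\<in>I. x j * P j k * x k)"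
    using I by (simp add: sum.distrib)
  also have "(\<Sum>k\<in>I. x i * P i k * x k) = x i * ?b"
    by (simp add: sum_distrib_left mult.assoc)
  also have "(\<Sum>j\<in>I. x j * P j i * x i) = x i * ?b"
    unfolding sym[of _ i] by (simp add: sum_distrib_left ac_simps)
  also have "(\<Sum>j\<in>I. \<Sum>k\<in>I. x j * P j k * x k) = (\<Sum>j\<in>I. \<Sum>k\<in>I. x j * (P j k - P i j * P i k / P i i) * x k) + ?b * ?b / P i i"
    unfolding sum_product sum_divide_distrib sum.distrib[symmetric]
    by (intro sum.cong refl) (simp add: field_simps)
  finally show ?thesis
    using p by (simp add: power2_eq_square field_simps)
qed

text \<open>
  Induction on the set \<open>I\<close> of integration variables: integrating out coordinate
  \<open>i\<close> gives a one-dimensional Gaussian integral and leaves the Schur complement, whose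
  determinant is \<open>det P / P $ i $ i\<close>. Requiring \<open>P\<close> to be the identity
  outside \<open>I\<close> makes \<open>det P\<close> the determinant of the submatrix indexed by
  \<open>I\<close>.
\<close>

lemma nn_integral_gaussian_PiM:
  fixes P :: "real ^ 'n ^ 'n"
  assumes "finite I" and "posdef_matrix P"
    and "\<And>j k. j \<notin> I \<or> k \<notin> I \<Longrightarrow> P $ j $ k = (if j = k then 1 else 0)"
  shows "0 < det P \<and>
    (\<integral>\<^sup>+ x. ennreal (exp (- (\<Sum>j\<in>I. \<Sum>k\<in>I. x j * P $ j $ k * x k) / 2)) \<partial>Pi\<^sub>M I (\<lambda>_. lborel))
      = ennreal (sqrt ((2 * pi) ^ card I / det P))"
  using assms
proof (induction I arbitrary: P rule: finite_induct)
  case empty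
  then have "P = mat 1"
    by (simp add: vec_eq_iff mat_def)
  then show ?case
    by (simp add: PiM_empty nn_integral_count_space_finite)
next
  case (insert i I)
  interpret product_sigma_finite "\<lambda>_::'n. lborel :: real measure"
    by standard
  let ?p = "P $ i $ i"
  define P' where "P' = (\<chi> j k. if j = i \<or> k = i then if j = k then 1 else 0
                        else P $ j $ k - P $ i $ j * P $ i $ k / P $ i $ i)"
  have p: "0 < ?p"
    by (rule posdef_matrix_diag_pos[OF insert.prems(1)])
  note schur = schur_complement_congruence[OF insert.prems(1), of i, folded P'_def]
  have out: "P' $ j $ k = (if j = k then 1 else 0)" if "j \<notin> I \<or> k \<notin> I" for j k
    using that insert.prems(2)[of j k] insert.prems(2)[of i k] insert.prems(2)[of i j]
    by (auto simp: P'_def)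
  let ?Q = "\<lambda>x. \<Sum>j\<in>I. \<Sum>k\<in>I. x j * P' $ j $ k * x k"
  have IH: "0 < det P' \<and>
      (\<integral>\<^sup>+ x. ennreal (exp (- ?Q x / 2)) \<partial>Pi\<^sub>M I (\<lambda>_. lborel)) = ennreal (sqrt ((2 * pi) ^ card I / det P'))"
    using insert.IH[OF schur(1)] out by blast
  have sq: "(\<Sum>j\<in>insert i I. \<Sum>k\<in>insert i I. (x(i := y)) j * P $ j $ k * (x(i := y)) k) =
      ?p * (y + (\<Sum>k\<in>I. P $ i $ k * x k) / ?p)\<^sup>2 + ?Q x" for x y
  proof -
    have upd_same: "(x(i := y)) i = y"
      by simp
    have upd: "(x(i := y)) k = x k" if "k \<in> I" for k
      using that insert.hyps by auto
    have Q: "?Q x = (\<Sum>j\<in>I. \<Sum>k\<in>I. x j * (P $ j $ k - P $ i $ j * P $ i $ k / ?p) * x k)"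
      using insert.hyps by (intro sum.cong refl) (auto simp: P'_def)
    show ?thesis
      unfolding Q using p posdef_matrix_symmetric[OF insert.prems(1)] insert.hyps
      by (subst complete_square_in_one_coordinate) (auto simp: upd upd_same simp del: fun_upd_apply cong: sum.cong_simp)
  qed
  have inner: "(\<integral>\<^sup>+ y. ennreal (exp (- (?p * (y + m)\<^sup>2) / 2)) * c \<partial>lborel) = ennreal (sqrt (2 * pi / ?p)) * c" for m c
    by (subst nn_integral_multc) (measurable, simp only: nn_integral_exp_shifted_square[OF p])
  have "(\<integral>\<^sup>+ x. ennreal (exp (- (\<Sum>j\<in>insert i I. \<Sum>k\<in>insert i I. x j * P $ j $ k * x k) / 2)) \<partial>Pi\<^sub>M (insert i I) (\<lambda>_. lborel))
     = (\<integral>\<^sup>+ x. \<integral>\<^sup>+ y. ennreal (exp (- (?p * (y + (\<Sum>k\<in>I. P $ i $ k * x k) / ?p)\<^sup>2) / 2)) * ennreal (exp (- ?Q x / 2)) \<partial>lborel \<partial>Pi\<^sub>M I (\<lambda>_. lborel))"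
    by (subst product_nn_integral_insert[OF insert.hyps], measurable)
       (simp only: sq ennreal_exp_neg_half_add)
  also have "\<dots> = ennreal (sqrt (2 * pi / ?p)) * ennreal (sqrt ((2 * pi) ^ card I / det P'))"
    unfolding inner by (subst nn_integral_cmult) (measurable, simp only: IH)
  also have "\<dots> = ennreal (sqrt ((2 * pi) ^ card (insert i I) / det P))"
    using p IH insert.hyps schur(2)
    by (simp add: ennreal_mult'[symmetric] real_sqrt_mult[symmetric] real_sqrt_divide)
  finally show ?case
    using IH p schur(2) by simp
qed

lemma lborel_vec_eq_distr_PiM:
  "(lborel :: (real ^ 'n) measure) = distr (Pi\<^sub>M UNIV (\<lambda>_. lborel)) borel (\<lambda>x. \<chi> i. x i)"
proof (rule lborel_eqI)
  interpret product_sigma_finite "\<lambda>_::'n. lborel :: real measure"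
    by standard
  fix l u :: "real ^ 'n" assume le: "\<And>b. b \<in> Basis \<Longrightarrow> l \<bullet> b \<le> u \<bullet> b"
  have le': "l $ i \<le> u $ i" for i
    using le[of "axis i 1"] by (simp add: inner_axis)
  have [measurable]: "(\<lambda>x. \<chi> i. x i) \<in> Pi\<^sub>M UNIV (\<lambda>_. lborel) \<rightarrow>\<^sub>M (borel :: (real ^ 'n) measure)"
    by (subst borel_measurable_euclidean_space) (auto simp: Basis_vec_def inner_axis)
  have "emeasure (distr (Pi\<^sub>M UNIV (\<lambda>_. lborel)) borel (\<lambda>x. \<chi> i. x i)) (box l u) =
      emeasure (Pi\<^sub>M UNIV (\<lambda>_. lborel)) (Pi\<^sub>E UNIV (\<lambda>i. {l $ i <..< u $ i}))"
    by (subst emeasure_distr) (auto simp: space_PiM box_def Basis_vec_def inner_axis intro!: arg_cong2[where f = emeasure])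
  also have "\<dots> = (\<Prod>i\<in>UNIV. ennreal (u $ i - l $ i))"
    using le' by (subst emeasure_PiM) auto
  also have "\<dots> = ennreal (\<Prod>i\<in>UNIV. u $ i - l $ i)"
    using le' by (intro prod_ennreal) simp
  also have "(\<Prod>i\<in>UNIV. u $ i - l $ i) = (\<Prod>b\<in>range (\<lambda>i. axis i 1). (u - l) \<bullet> b)"
    by (subst prod.reindex) (auto simp: inj_on_def axis_eq_axis inner_axis)
  also have "range (\<lambda>i. axis i 1) = (Basis :: (real ^ 'n) set)"
    by (auto simp: Basis_vec_def)
  finally show "emeasure (distr (Pi\<^sub>M UNIV (\<lambda>_. lborel)) borel (\<lambda>x. \<chi> i. x i)) (box l u) = ennreal (\<Prod>b\<in>Basis. (u - l) \<bullet> b)" .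
qed simp

lemma nn_integral_gaussian:
  fixes P :: "real ^ 'n ^ 'n"
  assumes "posdef_matrix P"
  shows "0 < det P"
    and "(\<integral>\<^sup>+ x. ennreal (exp (- (x \<bullet> (P *v x)) / 2)) \<partial>lborel) = ennreal (sqrt ((2 * pi) ^ CARD('n) / det P))"
proof -
  have [measurable]: "(\<lambda>x. \<chi> i. x i) \<in> Pi\<^sub>M UNIV (\<lambda>_. lborel) \<rightarrow>\<^sub>M (borel :: (real ^ 'n) measure)"
    by (subst borel_measurable_euclidean_space) (auto simp: Basis_vec_def inner_axis)
  have [measurable]: "(\<lambda>x. x \<bullet> (P *v x)) \<in> borel_measurable borel"
    by (intro borel_measurable_continuous_onI continuous_intros)
  have *: "0 < det P \<and>
      (\<integral>\<^sup>+ x. ennreal (exp (- (\<Sum>j\<in>UNIV. \<Sum>k\<in>UNIV. x j * P $ j $ k * x k) / 2)) \<partial>Pi\<^sub>M UNIV (\<lambda>_. lborel))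
        = ennreal (sqrt ((2 * pi) ^ CARD('n) / det P))"
    by (rule nn_integral_gaussian_PiM) (use assms in auto)
  then show "0 < det P" ..
  have "(\<integral>\<^sup>+ x. ennreal (exp (- (x \<bullet> (P *v x)) / 2)) \<partial>lborel) =
      (\<integral>\<^sup>+ x. ennreal (exp (- (\<Sum>j\<in>UNIV. \<Sum>k\<in>UNIV. x j * P $ j $ k * x k) / 2)) \<partial>Pi\<^sub>M UNIV (\<lambda>_. lborel))"
    by (subst lborel_vec_eq_distr_PiM, subst nn_integral_distr)
       (measurable, simp only: inner_matrix_vector_eq_sum vec_lambda_beta)
  with * show "(\<integral>\<^sup>+ x. ennreal (exp (- (x \<bullet> (P *v x)) / 2)) \<partial>lborel) = ennreal (sqrt ((2 * pi) ^ CARD('n) / det P))"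
    by simp
qed

text \<open>
  That the density is normalized for every covariance allows total masses to be compared across
  different factor covariances.
\<close>

lemma emeasure_mvnormal_UNIV:
  fixes S :: "real ^ 'n ^ 'n"
  assumes S: "posdef_matrix S"
  shows "emeasure (mvnormal S) UNIV = 1"
proof -
  let ?Q = "matrix_inv S"
  have det_S: "0 < det S"
    by (rule nn_integral_gaussian(1)[OF S])
  have "det S * det ?Q = 1"
    using posdef_matrix_invertible(1)[OF S] by (metis det_I det_mul)
  then have det_Q: "det ?Q = 1 / det S"
    using det_S by (simp add: field_simps)
  have [measurable]: "(\<lambda>x. x \<bullet> (?Q *v x)) \<in> borel_measurable borel"
    by (intro borel_measurable_continuous_onI continuous_intros)
  have "emeasure (mvnormal S) UNIV =
      (\<integral>\<^sup>+ x. ennreal (1 / sqrt ((2 * pi) ^ CARD('n) * det S)) * ennreal (exp (- (x \<bullet> (?Q *v x)) / 2)) \<partial>lborel)"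
    unfolding mvnormal_def using det_S
    by (subst emeasure_density) (auto simp: ennreal_mult'[symmetric])
  also have "\<dots> = ennreal (1 / sqrt ((2 * pi) ^ CARD('n) * det S)) * ennreal (sqrt ((2 * pi) ^ CARD('n) * det S))"
    by (subst nn_integral_cmult) (measurable, simp only: nn_integral_gaussian(2)[OF posdef_matrix_inv[OF S]] det_Q,
        simp)
  also have "\<dots> = 1"
    using det_S by (simp add: ennreal_mult'[symmetric])
  finally show ?thesis .
qed

text \<open>
  Gaussian conditioning: for \<open>y = A *v \<eta> + noise\<close>, the joint density of
  \<open>(\<eta>, y)\<close> is the marginal density of \<open>y\<close>, with covariance
  \<open>V\<close>, times the posterior density of \<open>\<eta>\<close>, with a precision matrix that
  does not depend on \<open>y\<close>.
\<close>

lemma complete_square_posterior: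
  fixes S :: "real ^ 'n ^ 'n" and A :: "real ^ 'n ^ 'j"
  assumes S: "posdef_matrix S" and V: "posdef_matrix V" "V = mat 1 + A ** S ** transpose A"
  shows "\<eta> \<bullet> (matrix_inv S *v \<eta>) + (A *v \<eta> - y) \<bullet> (A *v \<eta> - y) =
     y \<bullet> (matrix_inv V *v y) +
     (\<eta> - S *v (transpose A *v (matrix_inv V *v y))) \<bullet>
       ((matrix_inv S + transpose A ** A) *v (\<eta> - S *v (transpose A *v (matrix_inv V *v y))))"
proof -
  \<comment> \<open>\<open>S *v a\<close> is the minimizer in \<open>\<eta>\<close>, and \<open>u\<close> the deviation from it.\<close>
  define w where "w = matrix_inv V *v y"
  define a where "a = transpose A *v w"
  define u where "u = \<eta> - S *v a"
  have adj: "x \<bullet> (transpose A *v v) = (A *v x) \<bullet> v" for x v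
    by (metis dot_lmul_matrix inner_commute transpose_matrix_vector)
  have eta: "\<eta> = u + S *v a"
    by (simp add: u_def)
  have "y = V *v w"
    by (simp add: w_def posdef_matrix_mult_inv_vec[OF V(1)])
  also have "\<dots> = w + A *v (S *v a)"
    by (simp only: V(2) a_def matrix_vector_mult_add_rdistrib matrix_vector_mul_lid matrix_vector_mul_assoc matrix_mul_assoc)
  finally have y: "y = w + A *v (S *v a)" .
  have uPu: "u \<bullet> ((matrix_inv S + transpose A ** A) *v u) = u \<bullet> (matrix_inv S *v u) + (A *v u) \<bullet> (A *v u)"
  proof -
    have "(matrix_inv S + transpose A ** A) *v u = matrix_inv S *v u + transpose A *v (A *v u)"
      by (simp only: matrix_vector_mult_add_rdistrib matrix_vector_mul_assoc)
    then show ?thesis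
      by (simp only: inner_add_right adj)
  qed
  have Qa: "matrix_inv S *v (S *v a) = a"
    by (rule posdef_matrix_mult_inv_vec(2)[OF S])
  have "(S *v a) \<bullet> (matrix_inv S *v u) = a \<bullet> u"
    using posdef_matrix_inner_commute[OF posdef_matrix_inv[OF S], of "S *v a" u] by (simp only: Qa)
  then have "\<eta> \<bullet> (matrix_inv S *v \<eta>) = u \<bullet> (matrix_inv S *v u) + 2 * (u \<bullet> a) + (S *v a) \<bullet> a"
    unfolding eta matrix_vector_right_distrib inner_add_left inner_add_right Qa
    by (simp add: inner_commute[of a u])
  moreover have "A *v \<eta> - y = A *v u - w"
    unfolding eta y by (simp add: matrix_vector_right_distrib)
  then have "(A *v \<eta> - y) \<bullet> (A *v \<eta> - y) = (A *v u) \<bullet> (A *v u) - 2 * ((A *v u) \<bullet> w) + w \<bullet> w"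
    by (simp add: inner_diff_left inner_diff_right inner_commute)
  moreover have "(A *v u) \<bullet> w = u \<bullet> a"
    by (simp only: a_def adj)
  moreover have "y \<bullet> w = w \<bullet> w + (S *v a) \<bullet> a"
    unfolding y inner_add_left by (simp only: a_def adj)
  ultimately show ?thesis
    unfolding w_def[symmetric] a_def[symmetric] u_def[symmetric] uPu by linarith
qed

text \<open>
  The factor in front does not depend on \<open>y\<close>, so up to a constant only \<open>V\<close>
  survives the integration over \<open>\<eta>\<close>.
\<close>

lemma nn_integral_marginal_gaussian:
  fixes S :: "real ^ 'n ^ 'n" and A :: "real ^ 'n ^ 'j"
  assumes S: "posdef_matrix S" and V: "V = mat 1 + A ** S ** transpose A"
  shows "(\<integral>\<^sup>+ \<eta>. ennreal (exp (- (\<eta> \<bullet> (matrix_inv S *v \<eta>) + (A *v \<eta> - y) \<bullet> (A *v \<eta> - y)) / 2)) \<partial>lborel) =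
     ennreal (sqrt ((2 * pi) ^ CARD('n) / det (matrix_inv S + transpose A ** A))) * ennreal (exp (- (y \<bullet> (matrix_inv V *v y)) / 2))"
proof -
  let ?P = "matrix_inv S + transpose A ** A"
  let ?m = "S *v (transpose A *v (matrix_inv V *v y))"
  have posV: "posdef_matrix V"
    unfolding V by (rule posdef_matrix_marginal_cov[OF S])
  have [measurable]: "(\<lambda>x. x \<bullet> (?P *v x)) \<in> borel_measurable borel"
    by (intro borel_measurable_continuous_onI continuous_intros)
  have "(\<integral>\<^sup>+ \<eta>. ennreal (exp (- (\<eta> \<bullet> (matrix_inv S *v \<eta>) + (A *v \<eta> - y) \<bullet> (A *v \<eta> - y)) / 2)) \<partial>lborel) =
     (\<integral>\<^sup>+ \<eta>. ennreal (exp (- ((- ?m + \<eta>) \<bullet> (?P *v (- ?m + \<eta>))) / 2)) * ennreal (exp (- (y \<bullet> (matrix_inv V *v y)) / 2)) \<partial>lborel)"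
    unfolding complete_square_posterior[OF S posV V]
    by (simp only: ennreal_exp_neg_half_add mult.commute uminus_add_conv_diff)
  also have "\<dots> = (\<integral>\<^sup>+ u. ennreal (exp (- (u \<bullet> (?P *v u)) / 2)) * ennreal (exp (- (y \<bullet> (matrix_inv V *v y)) / 2)) \<partial>distr lborel borel ((+) (- ?m)))"
    by (subst nn_integral_distr) simp_all
  also have "\<dots> = (\<integral>\<^sup>+ u. ennreal (exp (- (u \<bullet> (?P *v u)) / 2)) \<partial>lborel) * ennreal (exp (- (y \<bullet> (matrix_inv V *v y)) / 2))"
    unfolding lborel_distr_plus by (rule nn_integral_multc) simp
  finally show ?thesis
    by (simp only: nn_integral_gaussian(2)[OF posdef_matrix_posterior_precision[OF S]])
qed

section \<open>The law of the responses\<close>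

lemma sum_option_UNIV:
  fixes f :: "'a::finite option \<Rightarrow> 'b::comm_monoid_add"
  shows "(\<Sum>k\<in>UNIV. f k) = f None + (\<Sum>g\<in>UNIV. f (Some g))"
  by (simp add: UNIV_option_conv sum.reindex)

lemma posdef_factor_cov:
  fixes S :: "real ^ 'g::finite ^ 'g"
  assumes S: "posdef_matrix S"
  shows "posdef_matrix (factor_cov S)"
  unfolding posdef_matrix_def
proof safe
  show "transpose (factor_cov S) = factor_cov S"
    using posdef_matrix_symmetric[OF S]
    by (simp add: vec_eq_iff transpose_def factor_cov_def split: option.split)
next
  fix x :: "real ^ 'g option" assume "x \<noteq> 0"
  let ?y = "\<chi> g. x $ Some g"
  have *: "x \<bullet> (factor_cov S *v x) = (x $ None)\<^sup>2 + ?y \<bullet> (S *v ?y)"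
    unfolding inner_matrix_vector_eq_sum
    by (simp add: sum_option_UNIV factor_cov_def power2_eq_square)
  show "0 < x \<bullet> (factor_cov S *v x)"
  proof (cases "x $ None = 0")
    case True
    have "?y \<noteq> 0"
    proof
      assume "?y = 0"
      then have "x $ k = 0" for k
        using True by (cases k) (simp_all add: vec_eq_iff)
      with \<open>x \<noteq> 0\<close> show False
        by (simp add: vec_eq_iff)
    qed
    then show ?thesis
      unfolding * using posdef_matrix_inner_pos[OF S] by (simp add: True)
  next
    case False
    then show ?thesis
      unfolding * using posdef_matrix_inner_nonneg[OF S, of ?y] by (simp add: add_pos_nonneg)
  qed
qed

text \<open>
  The covariance of the latent variables behind the responses: loadings times factors plus independent
  standard normal noise.
\<close>

definition marginal_cov :: "real ^ ('g::finite option) ^ 'j::finite \<Rightarrow> real ^ 'g ^ 'g \<Rightarrow> real ^ 'j ^ 'j" where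
  "marginal_cov A S = mat 1 + A ** factor_cov S ** transpose A"

lemma marginal_cov_entry:
  fixes testlet :: "'j::finite \<Rightarrow> 'g::finite"
  assumes A: "\<And>j h. h \<noteq> testlet j \<Longrightarrow> A $ j $ Some h = 0"
  shows "marginal_cov A S $ j $ k = (if j = k then 1 else 0) + A $ j $ None * A $ k $ None
     + A $ j $ Some (testlet j) * A $ k $ Some (testlet k) * S $ testlet j $ testlet k"
proof -
  have pick: "(\<Sum>h\<in>UNIV. A $ j $ Some h * F h) = A $ j $ Some (testlet j) * F (testlet j)" for j F
    by (subst sum.mono_neutral_right[of UNIV "{testlet j}"]) (auto simp: A)
  have pick': "(\<Sum>h\<in>UNIV. F h * A $ j $ Some h) = F (testlet j) * A $ j $ Some (testlet j)" for j F
    using pick[of j F] by (simp add: mult.commute)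
  show ?thesis
    by (simp add: marginal_cov_def matrix_matrix_mult_def transpose_def mat_def sum_option_UNIV factor_cov_def pick pick')
qed

lemma item_prob_eq_cdf_matrix:
  assumes A: "\<And>j h. h \<noteq> testlet j \<Longrightarrow> A $ j $ Some h = 0"
  shows "item_prob testlet A d \<eta> j = cdf std_normal_distribution (d $ j + (A *v \<eta>) $ j)"
proof -
  have "(\<Sum>h\<in>UNIV. A $ j $ Some h * \<eta> $ Some h) = A $ j $ Some (testlet j) * \<eta> $ Some (testlet j)"
    by (subst sum.mono_neutral_right[of UNIV "{testlet j}"]) (auto simp: A)
  then show ?thesis
    by (simp add: item_prob_def matrix_vector_mult_def sum_option_UNIV add.assoc)
qed

text \<open>
  A response is a thresholded latent variable: \<open>l * z\<close> plays the role of \<open>t\<close>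
  plus standard normal noise, and the response is 1 if and only if \<open>z \<ge> - \<delta>\<close>.
  Measuring the latent variable on the scale \<open>l\<close> removes the scale from the event.
\<close>

lemma std_normal_response_prob_eq_nn_integral:
  fixes l \<delta> t :: real
  assumes l: "0 < l"
  shows "ennreal (if b then cdf std_normal_distribution (l * \<delta> + t) else 1 - cdf std_normal_distribution (l * \<delta> + t)) =
     (\<integral>\<^sup>+ z. ennreal (l * std_normal_density (t - l * z)) * indicator {z. (- \<delta> \<le> z) = b} z \<partial>lborel)"
proof -
  interpret real_distribution std_normal_distribution by (rule real_dist_normal_dist)
  define B where "B = (if b then {..l * \<delta> + t} else - {..l * \<delta> + t})"
  have [measurable]: "B \<in> sets borel"
    by (simp add: B_def)
  have "measure std_normal_distribution (- {..x}) = 1 - measure std_normal_distribution {..x}" for x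
    using prob_compl[of "{..x}"] by (simp add: Compl_eq_Diff_UNIV)
  then have "ennreal (if b then cdf std_normal_distribution (l * \<delta> + t) else 1 - cdf std_normal_distribution (l * \<delta> + t)) =
      emeasure std_normal_distribution B"
    by (auto simp: B_def cdf_def emeasure_eq_measure)
  also have "\<dots> = (\<integral>\<^sup>+ e. ennreal (std_normal_density e) * indicator B e \<partial>lborel)"
    by (simp add: emeasure_density)
  \<comment> \<open>Substitute \<open>e = t - l * z\<close>; then \<open>e \<le> l * \<delta> + t\<close> becomes \<open>- \<delta> \<le> z\<close>, which no longer involves \<open>t\<close>.\<close>
  also have "\<dots> = ennreal l * (\<integral>\<^sup>+ z. ennreal (std_normal_density (t + (- l) * z)) * indicator B (t + (- l) * z) \<partial>lborel)"
    using l by (subst nn_integral_real_affine[where c = "- l" and t = t]) auto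
  also have "\<dots> = (\<integral>\<^sup>+ z. ennreal l * (ennreal (std_normal_density (t + (- l) * z)) * indicator B (t + (- l) * z)) \<partial>lborel)"
    by (subst nn_integral_cmult) auto
  also have "\<dots> = (\<integral>\<^sup>+ z. ennreal (l * std_normal_density (t - l * z)) * indicator {z. (- \<delta> \<le> z) = b} z \<partial>lborel)"
  proof (intro nn_integral_cong)
    fix z :: real
    have "l * (- \<delta>) \<le> l * z \<longleftrightarrow> - \<delta> \<le> z"
      using l by (simp only: mult_le_cancel_left_pos)
    then have "indicator B (t + (- l) * z) = (indicator {z. (- \<delta> \<le> z) = b} z :: ennreal)"
      by (auto simp: B_def indicator_def)
    then show "ennreal l * (ennreal (std_normal_density (t + (- l) * z)) * indicator B (t + (- l) * z)) =
        ennreal (l * std_normal_density (t - l * z)) * indicator {z. (- \<delta> \<le> z) = b} z"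
      using l by (simp add: ennreal_mult mult.assoc)
  qed
  finally show ?thesis .
qed

text \<open>
  Conditional independence turns the product of the one-dimensional integrals into one integral over
  the latent vector.
\<close>

lemma conditional_response_prob_eq_nn_integral:
  fixes t l \<delta> :: "'j::finite \<Rightarrow> real"
  assumes l: "\<And>j. 0 < l j"
  shows "ennreal (\<Prod>j\<in>UNIV. if y j then cdf std_normal_distribution (l j * \<delta> j + t j)
                           else 1 - cdf std_normal_distribution (l j * \<delta> j + t j)) =
    (\<integral>\<^sup>+ z. ennreal ((\<Prod>j\<in>UNIV. l j) / sqrt (2 * pi) ^ CARD('j)) * ennreal (exp (- (\<Sum>j\<in>UNIV. (t j - l j * z j)\<^sup>2) / 2))
        * (\<Prod>j\<in>UNIV. indicator {x. (- \<delta> j \<le> x) = y j} (z j)) \<partial>Pi\<^sub>M UNIV (\<lambda>_. lborel))"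
proof -
  interpret product_sigma_finite "\<lambda>_::'j. lborel :: real measure"
    by standard
  interpret N: real_distribution std_normal_distribution by (rule real_dist_normal_dist)
  have [measurable]: "{x. (- \<delta> j \<le> x) = y j} \<in> sets borel" for j
    by measurable
  have "ennreal (\<Prod>j\<in>UNIV. if y j then cdf std_normal_distribution (l j * \<delta> j + t j)
                           else 1 - cdf std_normal_distribution (l j * \<delta> j + t j)) =
     (\<Prod>j\<in>UNIV. \<integral>\<^sup>+ x. ennreal (l j * std_normal_density (t j - l j * x)) * indicator {x. (- \<delta> j \<le> x) = y j} x \<partial>lborel)"
    unfolding std_normal_response_prob_eq_nn_integral[OF l, symmetric]
    by (rule prod_ennreal[symmetric]) (simp add: N.cdf_nonneg N.cdf_bounded_prob)
  also have "\<dots> = (\<integral>\<^sup>+ z. (\<Prod>j\<in>UNIV. ennreal (l j * std_normal_density (t j - l j * z j)) * indicator {x. (- \<delta> j \<le> x) = y j} (z j)) \<partial>Pi\<^sub>M UNIV (\<lambda>_. lborel))"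
    by (rule product_nn_integral_prod[symmetric]) auto
  also have "\<dots> = (\<integral>\<^sup>+ z. ennreal ((\<Prod>j\<in>UNIV. l j) / sqrt (2 * pi) ^ CARD('j)) * ennreal (exp (- (\<Sum>j\<in>UNIV. (t j - l j * z j)\<^sup>2) / 2))
        * (\<Prod>j\<in>UNIV. indicator {x. (- \<delta> j \<le> x) = y j} (z j)) \<partial>Pi\<^sub>M UNIV (\<lambda>_. lborel))"
  proof (intro nn_integral_cong)
    fix z :: "'j \<Rightarrow> real"
    have "(\<Prod>j\<in>UNIV. l j * std_normal_density (t j - l j * z j)) =
        (\<Prod>j\<in>UNIV. l j) * (\<Prod>j\<in>(UNIV::'j set). 1 / sqrt (2 * pi)) * (\<Prod>j\<in>UNIV. exp (- (t j - l j * z j)\<^sup>2 / 2))"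
      unfolding std_normal_density_def prod.distrib by (simp only: mult.assoc)
    also have "(\<Prod>j\<in>UNIV. exp (- (t j - l j * z j)\<^sup>2 / 2)) = exp (- (\<Sum>j\<in>UNIV. (t j - l j * z j)\<^sup>2) / 2)"
      by (simp add: exp_sum[symmetric] sum_negf sum_divide_distrib)
    also have "(\<Prod>j\<in>(UNIV::'j set). 1 / sqrt (2 * pi)) = 1 / sqrt (2 * pi) ^ CARD('j)"
      by (simp add: power_one_over)
    finally have "(\<Prod>j\<in>UNIV. l j * std_normal_density (t j - l j * z j)) =
        (\<Prod>j\<in>UNIV. l j) / sqrt (2 * pi) ^ CARD('j) * exp (- (\<Sum>j\<in>UNIV. (t j - l j * z j)\<^sup>2) / 2)"
      by simp
    moreover have "(\<Prod>j\<in>UNIV. ennreal (l j * std_normal_density (t j - l j * z j))) = ennreal (\<Prod>j\<in>UNIV. l j * std_normal_density (t j - l j * z j))"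
      using l by (intro prod_ennreal) (simp add: less_imp_le)
    ultimately show "(\<Prod>j\<in>UNIV. ennreal (l j * std_normal_density (t j - l j * z j)) * indicator {x. (- \<delta> j \<le> x) = y j} (z j)) =
        ennreal ((\<Prod>j\<in>UNIV. l j) / sqrt (2 * pi) ^ CARD('j)) * ennreal (exp (- (\<Sum>j\<in>UNIV. (t j - l j * z j)\<^sup>2) / 2))
        * (\<Prod>j\<in>UNIV. indicator {x. (- \<delta> j \<le> x) = y j} (z j))"
      unfolding prod.distrib by (simp only: ennreal_mult'' exp_ge_zero)
  qed
  finally show ?thesis .
qed

text \<open>
  Integrating out the factors leaves a centred Gaussian density for the latent variables, which
  depends on the parameters only through the marginal covariance. The constant \<open>K\<close> is
  left unspecified because the total mass determines it.
\<close>

lemma emeasure_response_dist_eq_gaussian_integral: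
  fixes testlet :: "'j::finite \<Rightarrow> 'g::finite" and l \<delta> :: "'j \<Rightarrow> real"
  assumes A: "\<And>j h. h \<noteq> testlet j \<Longrightarrow> A $ j $ Some h = 0" and S: "posdef_matrix S"
    and l: "\<And>j. 0 < l j" and d: "\<And>j. d $ j = l j * \<delta> j"
  shows "\<exists>K. \<forall>y. emeasure (response_dist testlet (A, d, S)) {y} = K *
    (\<integral>\<^sup>+ z. ennreal (exp (- ((\<chi> j. l j * z j) \<bullet> (matrix_inv (marginal_cov A S) *v (\<chi> j. l j * z j))) / 2))
        * (\<Prod>j\<in>UNIV. indicator {x. (- \<delta> j \<le> x) = y j} (z j)) \<partial>Pi\<^sub>M UNIV (\<lambda>_. lborel))"
proof -
  let ?C = "factor_cov S"
  let ?M = "Pi\<^sub>M UNIV (\<lambda>_. lborel) :: ('j \<Rightarrow> real) measure"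
  let ?V = "marginal_cov A S"
  let ?v = "\<lambda>z. (\<chi> j. l j * z j) :: real ^ 'j"
  let ?I = "\<lambda>y z. \<Prod>j\<in>UNIV. indicator {x. (- \<delta> j \<le> x) = y j} (z j) :: ennreal"
  let ?E = "\<lambda>\<eta> z. exp (- (\<eta> \<bullet> (matrix_inv ?C *v \<eta>) + (\<Sum>j\<in>UNIV. ((A *v \<eta>) $ j - l j * z j)\<^sup>2)) / 2)"
  define c where "c = 1 / sqrt ((2 * pi) ^ CARD('g option) * det ?C)"
  define L where "L = (\<Prod>j\<in>UNIV. l j) / sqrt (2 * pi) ^ CARD('j)"
  define K where "K = sqrt ((2 * pi) ^ CARD('g option) / det (matrix_inv ?C + transpose A ** A))"
  have C: "posdef_matrix ?C"
    by (rule posdef_factor_cov[OF S])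
  have [measurable]: "(\<lambda>\<eta>. \<eta> \<bullet> (matrix_inv ?C *v \<eta>)) \<in> borel_measurable borel"
    by (intro borel_measurable_continuous_onI continuous_intros)
  have [measurable]: "(\<lambda>\<eta>. (A *v \<eta>) $ j) \<in> borel_measurable borel" for j
    by (intro borel_measurable_continuous_onI continuous_intros)
  have [measurable]: "{x. (- \<delta> j \<le> x) = y j} \<in> sets borel" for j y
    by measurable
  interpret product_sigma_finite "\<lambda>_::'j. lborel :: real measure"
    by standard
  interpret Z: sigma_finite_measure ?M
    by (rule sigma_finite) simp
  interpret pair_sigma_finite ?M "lborel :: (real ^ 'g option) measure"
    by standard
  have sq: "(A *v \<eta> - ?v z) \<bullet> (A *v \<eta> - ?v z) = (\<Sum>j\<in>UNIV. ((A *v \<eta>) $ j - l j * z j)\<^sup>2)" for \<eta> z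
    by (simp add: inner_vec_def power2_eq_square)
  have item_prob: "item_prob testlet A d \<eta> j = cdf std_normal_distribution (l j * \<delta> j + (A *v \<eta>) $ j)" for \<eta> j
    unfolding d[symmetric] by (rule item_prob_eq_cdf_matrix) (rule A)
  have "emeasure (response_dist testlet (A, d, S)) {y} =
      ennreal c * ennreal L * ennreal K * (\<integral>\<^sup>+ z. ennreal (exp (- (?v z \<bullet> (matrix_inv ?V *v ?v z)) / 2)) * ?I y z \<partial>?M)" for y
  proof -
    have "emeasure (response_dist testlet (A, d, S)) {y} =
       (\<integral>\<^sup>+ \<eta>. (\<integral>\<^sup>+ z. ennreal L * ennreal (exp (- (\<Sum>j\<in>UNIV. ((A *v \<eta>) $ j - l j * z j)\<^sup>2) / 2)) * ?I y z \<partial>?M) \<partial>mvnormal ?C)"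
      unfolding emeasure_response_dist item_prob L_def
      by (intro nn_integral_cong conditional_response_prob_eq_nn_integral l)
    also have "\<dots> = (\<integral>\<^sup>+ \<eta>. ennreal (exp (- (\<eta> \<bullet> (matrix_inv ?C *v \<eta>)) / 2) / sqrt ((2 * pi) ^ CARD('g option) * det ?C)) *
        (\<integral>\<^sup>+ z. ennreal L * ennreal (exp (- (\<Sum>j\<in>UNIV. ((A *v \<eta>) $ j - l j * z j)\<^sup>2) / 2)) * ?I y z \<partial>?M) \<partial>lborel)"
      unfolding mvnormal_def by (rule nn_integral_density) measurable
    also have "\<dots> = (\<integral>\<^sup>+ \<eta>. (\<integral>\<^sup>+ z. ennreal c * ennreal L * (ennreal (?E \<eta> z) * ?I y z) \<partial>?M) \<partial>lborel)"
    proof (intro nn_integral_cong)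
      fix \<eta> :: "real ^ 'g option"
      have "ennreal (exp (- (\<eta> \<bullet> (matrix_inv ?C *v \<eta>)) / 2) / sqrt ((2 * pi) ^ CARD('g option) * det ?C)) =
          ennreal c * ennreal (exp (- (\<eta> \<bullet> (matrix_inv ?C *v \<eta>)) / 2))"
        by (subst ennreal_mult''[symmetric]) (simp_all add: c_def)
      then show "ennreal (exp (- (\<eta> \<bullet> (matrix_inv ?C *v \<eta>)) / 2) / sqrt ((2 * pi) ^ CARD('g option) * det ?C)) *
          (\<integral>\<^sup>+ z. ennreal L * ennreal (exp (- (\<Sum>j\<in>UNIV. ((A *v \<eta>) $ j - l j * z j)\<^sup>2) / 2)) * ?I y z \<partial>?M) =
          (\<integral>\<^sup>+ z. ennreal c * ennreal L * (ennreal (?E \<eta> z) * ?I y z) \<partial>?M)"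
        by (subst nn_integral_cmult[symmetric]) (measurable, simp only: ennreal_exp_neg_half_add ac_simps)
    qed
    also have "\<dots> = (\<integral>\<^sup>+ z. (\<integral>\<^sup>+ \<eta>. ennreal c * ennreal L * (ennreal (?E \<eta> z) * ?I y z) \<partial>lborel) \<partial>?M)"
      by (rule Fubini') measurable
    also have "\<dots> = (\<integral>\<^sup>+ z. ennreal c * ennreal L * ennreal K * (ennreal (exp (- (?v z \<bullet> (matrix_inv ?V *v ?v z)) / 2)) * ?I y z) \<partial>?M)"
    proof (intro nn_integral_cong)
      fix z :: "'j \<Rightarrow> real"
      have "(\<integral>\<^sup>+ \<eta>. ennreal c * ennreal L * (ennreal (?E \<eta> z) * ?I y z) \<partial>lborel) =
          ennreal c * ennreal L * ((\<integral>\<^sup>+ \<eta>. ennreal (?E \<eta> z) \<partial>lborel) * ?I y z)"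
        by (subst nn_integral_cmult, measurable, subst nn_integral_multc, measurable)
      also have "(\<integral>\<^sup>+ \<eta>. ennreal (?E \<eta> z) \<partial>lborel) = ennreal K * ennreal (exp (- (?v z \<bullet> (matrix_inv ?V *v ?v z)) / 2))"
        unfolding sq[symmetric] K_def by (rule nn_integral_marginal_gaussian[OF C]) (simp add: marginal_cov_def)
      finally show "(\<integral>\<^sup>+ \<eta>. ennreal c * ennreal L * (ennreal (?E \<eta> z) * ?I y z) \<partial>lborel) =
          ennreal c * ennreal L * ennreal K * (ennreal (exp (- (?v z \<bullet> (matrix_inv ?V *v ?v z)) / 2)) * ?I y z)"
        by (simp only: ac_simps)
    qed
    also have "\<dots> = ennreal c * ennreal L * ennreal K * (\<integral>\<^sup>+ z. ennreal (exp (- (?v z \<bullet> (matrix_inv ?V *v ?v z)) / 2)) * ?I y z \<partial>?M)"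
    proof (rule nn_integral_cmult)
      have "(\<lambda>z. exp (- (\<Sum>j\<in>UNIV. \<Sum>k\<in>UNIV. l j * z j * matrix_inv ?V $ j $ k * (l k * z k)) / 2)) \<in> borel_measurable ?M"
        by measurable
      then have [measurable]: "(\<lambda>z. exp (- (?v z \<bullet> (matrix_inv ?V *v ?v z)) / 2)) \<in> borel_measurable ?M"
        by (simp only: inner_matrix_vector_eq_sum vec_lambda_beta)
      show "(\<lambda>z. ennreal (exp (- (?v z \<bullet> (matrix_inv ?V *v ?v z)) / 2)) * ?I y z) \<in> borel_measurable ?M"
        by measurable
    qed
    finally show ?thesis .
  qed
  then show ?thesis
    by blast
qed

lemma sum_emeasure_response_dist:
  fixes testlet :: "'j::finite \<Rightarrow> 'g::finite"
  assumes S: "posdef_matrix S"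
  shows "(\<Sum>y\<in>UNIV. emeasure (response_dist testlet (A, d, S)) {y}) = 1"
proof -
  have sets: "sets (mvnormal (factor_cov S)) = sets borel"
    by (simp add: mvnormal_def)
  have "(\<Sum>y\<in>UNIV. emeasure (response_dist testlet (A, d, S)) {y}) =
     (\<integral>\<^sup>+ \<eta>. (\<Sum>y\<in>UNIV. ennreal (\<Prod>j\<in>UNIV. if y j then item_prob testlet A d \<eta> j else 1 - item_prob testlet A d \<eta> j))
        \<partial>mvnormal (factor_cov S))"
    unfolding emeasure_response_dist
    by (rule nn_integral_sum[symmetric]) (simp add: measurable_cong_sets[OF sets refl])
  also have "\<dots> = (\<integral>\<^sup>+ \<eta>. 1 \<partial>mvnormal (factor_cov S))"
  proof (intro nn_integral_cong)
    fix \<eta> :: "real ^ 'g option"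
    have "(\<Sum>y\<in>UNIV. ennreal (pmf (cond_response testlet A d \<eta>) y)) = ennreal (\<Sum>y\<in>UNIV. pmf (cond_response testlet A d \<eta>) y)"
      by (rule sum_ennreal) simp
    also have "(\<Sum>y\<in>UNIV. pmf (cond_response testlet A d \<eta>) y) = 1"
      by (rule sum_pmf_eq_1) auto
    finally show "(\<Sum>y\<in>UNIV. ennreal (\<Prod>j\<in>UNIV. if y j then item_prob testlet A d \<eta> j else 1 - item_prob testlet A d \<eta> j)) = 1"
      by (simp add: pmf_cond_response)
  qed
  also have "\<dots> = 1"
    using emeasure_mvnormal_UNIV[OF posdef_factor_cov[OF S]] by (simp add: mvnormal_def)
  finally show ?thesis .
qed

lemma inner_matrix_inv_rescale:
  fixes V V' :: "real ^ 'j ^ 'j"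
  assumes V: "posdef_matrix V" and V': "posdef_matrix V'" and l: "\<And>j. 0 < l j"
    and scale: "\<And>j k. V' $ j $ k = l j * l k * V $ j $ k"
  shows "(\<chi> j. l j * z j) \<bullet> (matrix_inv V' *v (\<chi> j. l j * z j)) = (\<chi> j. z j) \<bullet> (matrix_inv V *v (\<chi> j. z j))"
proof -
  define w where "w = matrix_inv V *v (\<chi> j. z j)"
  have "V *v w = (\<chi> j. z j)"
    by (simp add: w_def posdef_matrix_mult_inv_vec[OF V])
  then have Vw: "(\<Sum>k\<in>UNIV. V $ j $ k * w $ k) = z j" for j
    by (simp add: vec_eq_iff matrix_vector_mult_def)
  \<comment> \<open>Scaling the variables by \<open>l\<close> scales the solution of the linear system by \<open>1 / l\<close>.\<close>
  have "V' *v (\<chi> k. w $ k / l k) = (\<chi> j. l j * z j)"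
  proof (simp add: vec_eq_iff matrix_vector_mult_def, intro allI)
    fix j
    have "(\<Sum>k\<in>UNIV. V' $ j $ k * w $ k / l k) = (\<Sum>k\<in>UNIV. l j * (V $ j $ k * w $ k))"
      using l by (intro sum.cong refl) (simp add: scale field_simps less_imp_neq[symmetric])
    then show "(\<Sum>k\<in>UNIV. V' $ j $ k * w $ k / l k) = l j * z j"
      by (simp add: sum_distrib_left[symmetric] Vw)
  qed
  then have "matrix_inv V' *v (\<chi> j. l j * z j) = (\<chi> k. w $ k / l k)"
    by (metis posdef_matrix_mult_inv_vec(2)[OF V'])
  then show ?thesis
    using l by (simp add: w_def[symmetric] inner_vec_def less_imp_neq[symmetric])
qed

text \<open>
  Dividing a latent variable by \<open>l j\<close> does not change its sign, so only standardized
  thresholds and latent correlations can be inferred from the responses. All the failures of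
  identifiability below are instances of this criterion.
\<close>

lemma response_dist_eqI:
  fixes testlet :: "'j::finite \<Rightarrow> 'g::finite" and l :: "'j \<Rightarrow> real"
  assumes A: "\<And>j h. h \<noteq> testlet j \<Longrightarrow> A $ j $ Some h = 0" and S: "posdef_matrix S"
    and A': "\<And>j h. h \<noteq> testlet j \<Longrightarrow> A' $ j $ Some h = 0" and S': "posdef_matrix S'"
    and l: "\<And>j. 0 < l j" and d': "\<And>j. d' $ j = l j * d $ j"
    and cov: "\<And>j k. marginal_cov A' S' $ j $ k = l j * l k * marginal_cov A S $ j $ k"
  shows "response_dist testlet (A', d', S') = response_dist testlet (A, d, S)"
proof -
  let ?M = "Pi\<^sub>M UNIV (\<lambda>_. lborel) :: ('j \<Rightarrow> real) measure"
  let ?V = "marginal_cov A S" and ?V' = "marginal_cov A' S'"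
  define F where "F y = (\<integral>\<^sup>+ z. ennreal (exp (- ((\<chi> j. z j) \<bullet> (matrix_inv ?V *v (\<chi> j. z j))) / 2))
        * (\<Prod>j\<in>UNIV. indicator {x. (- d $ j \<le> x) = y j} (z j)) \<partial>?M)" for y
  have V: "posdef_matrix ?V" and V': "posdef_matrix ?V'"
    unfolding marginal_cov_def by (intro posdef_matrix_marginal_cov posdef_factor_cov S S')+
  obtain K where K: "emeasure (response_dist testlet (A, d, S)) {y} = K * F y" for y
    using emeasure_response_dist_eq_gaussian_integral[OF A S, where l = "\<lambda>_. 1" and d = d and \<delta> = "\<lambda>j. d $ j"]
    unfolding F_def mult_1 by auto
  obtain K' where K': "emeasure (response_dist testlet (A', d', S')) {y} = K' * F y" for y
    using emeasure_response_dist_eq_gaussian_integral[OF A' S' l d']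
    unfolding F_def inner_matrix_inv_rescale[OF V V' l cov] by auto
  \<comment> \<open>Both laws have total mass 1, which determines the common normalizing constant.\<close>
  have "K * (\<Sum>y\<in>UNIV. F y) = 1" "K' * (\<Sum>y\<in>UNIV. F y) = 1"
    using sum_emeasure_response_dist[OF S, of testlet A d] sum_emeasure_response_dist[OF S', of testlet A' d']
    by (simp_all add: K K' sum_distrib_left)
  then have "K = K'"
    by (metis mult.assoc mult.commute mult_1)
  have sets: "sets (response_dist testlet \<theta>) = UNIV" for \<theta> :: "('j, 'g) bifactor_params"
  proof -
    obtain A d S where \<theta>: "\<theta> = (A, d, S)"
      by (cases \<theta>) auto
    show ?thesis
      unfolding \<theta> response_dist_def split
      by (subst sets_bind[of _ _ "count_space UNIV"]) (auto simp: mvnormal_def)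
  qed
  show ?thesis
  proof (rule measure_eqI_finite[of _ UNIV])
    show "emeasure (response_dist testlet (A', d', S')) {y} = emeasure (response_dist testlet (A, d, S)) {y}" for y
      unfolding K K' \<open>K = K'\<close> ..
  qed (simp_all add: sets)
qed

section \<open>Indistinguishable parameters\<close>

lemma param_spaceD:
  assumes "(A, d, S) \<in> param_space testlet"
  shows "\<And>j h. h \<noteq> testlet j \<Longrightarrow> A $ j $ Some h = 0" "posdef_matrix S" "\<And>g. S $ g $ g = 1"
    "\<And>j k. A $ j $ k \<noteq> 0 \<Longrightarrow> (\<And>i. i < j \<Longrightarrow> A $ i $ k = 0) \<Longrightarrow> 0 < A $ j $ k"
  using assms by (auto simp: param_space_def)

text \<open>
  Changing the sign of a factor changes no covariance. Hence the sign convention of the parameter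
  space can always be restored, and does not restrict the constructions as long as the result is
  distinguished by squares of loadings.
\<close>

lemma exists_sign_normalized:
  fixes testlet :: "'j::{finite,linorder} \<Rightarrow> 'g::finite"
  assumes A: "\<And>j h. h \<noteq> testlet j \<Longrightarrow> A $ j $ Some h = 0" and S: "posdef_matrix S"
    and diag: "\<And>g. S $ g $ g = 1"
  shows "\<exists>A' S'. (A', d, S') \<in> param_space testlet \<and>
     response_dist testlet (A', d, S') = response_dist testlet (A, d, S) \<and>
     (\<forall>j k. (A' $ j $ k)\<^sup>2 = (A $ j $ k)\<^sup>2)"
proof -
  \<comment> \<open>\<open>e k\<close> is negative exactly if the first nonzero entry of column \<open>k\<close> is negative.\<close>
  define e :: "'g option \<Rightarrow> real" where
    "e k = (if \<exists>j. A $ j $ k < 0 \<and> (\<forall>i<j. A $ i $ k = 0) then - 1 else 1)" for k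
  have e2: "e k * e k = 1" for k
    by (simp add: e_def)
  have e_nz: "e k \<noteq> 0" for k
    by (simp add: e_def)
  define A' where "A' = ((\<chi> j k. e k * A $ j $ k))"
  define S' where "S' = ((\<chi> g h. e (Some g) * e (Some h) * S $ g $ h) :: real ^ 'g ^ 'g)"
  have pos: "A' $ j $ k > 0" if nz: "A' $ j $ k \<noteq> 0" and first: "\<forall>i<j. A' $ i $ k = 0" for j k
  proof -
    have first': "A $ i $ k = 0" if "i < j" for i
      using first that e_nz by (auto simp: A'_def)
    consider "A $ j $ k < 0" | "A $ j $ k > 0"
      using nz by (fastforce simp: A'_def)
    then show ?thesis
    proof cases
      case 1
      then have "e k = - 1"
        using first' by (auto simp: e_def)
      then show ?thesis
        using 1 by (simp add: A'_def)
    next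
      case 2
      have "e k = 1"
      proof (rule ccontr)
        assume "e k \<noteq> 1"
        then obtain i where "A $ i $ k < 0" "\<forall>i'<i. A $ i' $ k = 0"
          by (auto simp: e_def split: if_splits)
        then show False
          using 2 first' by (cases i j rule: linorder_cases) auto
      qed
      then show ?thesis
        using 2 by (simp add: A'_def)
    qed
  qed
  have A'_zero: "A' $ j $ Some h = 0" if "h \<noteq> testlet j" for j h
    using A[OF that] by (simp add: A'_def)
  have S'_pd: "posdef_matrix S'"
    unfolding posdef_matrix_def
  proof safe
    show "transpose S' = S'"
      using posdef_matrix_symmetric[OF S] by (simp add: S'_def transpose_def vec_eq_iff mult.commute)
  next
    fix x :: "real ^ 'g" assume "x \<noteq> 0"
    let ?y = "\<chi> g. e (Some g) * x $ g"
    have "?y \<noteq> 0"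
      using \<open>x \<noteq> 0\<close> e_nz by (auto simp: vec_eq_iff)
    moreover have "x \<bullet> (S' *v x) = ?y \<bullet> (S *v ?y)"
      unfolding inner_matrix_vector_eq_sum by (simp add: S'_def ac_simps)
    ultimately show "0 < x \<bullet> (S' *v x)"
      using posdef_matrix_inner_pos[OF S] by simp
  qed
  have "(A', d, S') \<in> param_space testlet"
    using pos A'_zero S'_pd by (auto simp: param_space_def S'_def diag e2)
  moreover have "response_dist testlet (A', d, S') = response_dist testlet (A, d, S)"
  proof (rule response_dist_eqI[OF A S A'_zero S'_pd, where l = "\<lambda>_. 1"])
    fix j k
    have e_cancel: "e k * a * (e k * b) = a * b" "e k * a * (e l * b) * (e k * e l * s) = a * b * s" for k l a b s
      using e2[of k] e2[of l] by algebra+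
    have cov: "marginal_cov A S $ a $ b = (if a = b then 1 else 0) + A $ a $ None * A $ b $ None
        + A $ a $ Some (testlet a) * A $ b $ Some (testlet b) * S $ testlet a $ testlet b" for a b
      by (rule marginal_cov_entry) (rule A)
    have cov': "marginal_cov A' S' $ a $ b = (if a = b then 1 else 0) + A' $ a $ None * A' $ b $ None
        + A' $ a $ Some (testlet a) * A' $ b $ Some (testlet b) * S' $ testlet a $ testlet b" for a b
      by (rule marginal_cov_entry) (rule A'_zero)
    show "marginal_cov A' S' $ j $ k = 1 * 1 * marginal_cov A S $ j $ k"
      unfolding cov cov'
      unfolding A'_def S'_def vec_lambda_beta e_cancel mult_1 ..
  qed simp_all
  moreover have "(A' $ j $ k)\<^sup>2 = (A $ j $ k)\<^sup>2" for j k
    using e2[of k] by (simp add: A'_def power2_eq_square)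
  ultimately show ?thesis
    by blast
qed

text \<open>
  The covariance of new testlet factors
  \<open>m h * \<eta>\<^sub>0 + p h * \<eta>\<^sub>h + q h * \<eta>\<^sub>g\<close> with
  \<open>g = g\<^sub>0\<close>, where \<open>\<eta>\<^sub>0\<close> is the old main factor and
  \<open>\<eta>\<^sub>h\<close>, \<open>\<eta>\<^sub>g\<close> are old testlet factors.
\<close>

definition mixed_cov :: "'g::finite \<Rightarrow> ('g \<Rightarrow> real) \<Rightarrow> ('g \<Rightarrow> real) \<Rightarrow> ('g \<Rightarrow> real) \<Rightarrow> real ^ 'g ^ 'g \<Rightarrow> real ^ 'g ^ 'g" where
  "mixed_cov g\<^sub>0 m p q S = (\<chi> h k. m h * m k + p h * p k * S $ h $ k + p h * q k * S $ h $ g\<^sub>0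
     + q h * p k * S $ g\<^sub>0 $ k + q h * q k * S $ g\<^sub>0 $ g\<^sub>0)"

lemma posdef_mixed_cov:
  fixes S :: "real ^ 'g::finite ^ 'g"
  assumes S: "posdef_matrix S" and p: "\<And>h. h \<noteq> g\<^sub>0 \<Longrightarrow> p h \<noteq> 0" "p g\<^sub>0 = 0" and m: "m g\<^sub>0 \<noteq> 0"
  shows "posdef_matrix (mixed_cov g\<^sub>0 m p q S)"
proof -
  \<comment> \<open>The rows of \<open>M\<close> are the coefficients of the new factors; they are linearly independent, since
    for \<open>a \<noteq> g\<^sub>0\<close> column \<open>Some a\<close> is nonzero only in row \<open>a\<close>, and \<open>m g\<^sub>0 \<noteq> 0\<close>.\<close>
  define M :: "real ^ ('g option) ^ 'g" where
    "M = (\<chi> h k. case k of None \<Rightarrow> m h | Some a \<Rightarrow> (if a = h then p h else 0) + (if a = g\<^sub>0 then q h else 0))"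
  have M_None: "M $ h $ None = m h"
    and M_Some: "M $ h $ Some a = (if a = h then p h else 0) + (if a = g\<^sub>0 then q h else 0)" for h a
    by (simp_all add: M_def)
  have "M ** factor_cov S ** transpose M = mixed_cov g\<^sub>0 m p q S"
  proof -
    have pick: "(\<Sum>a\<in>UNIV. M $ h $ Some a * F a) = p h * F h + q h * F g\<^sub>0" for h F
      by (simp add: M_Some distrib_right sum.distrib if_distrib[where f = "\<lambda>x. x * _"] cong: if_cong)
    have pick': "(\<Sum>a\<in>UNIV. F a * M $ h $ Some a) = p h * F h + q h * F g\<^sub>0" for h F
      using pick[of h F] by (simp add: mult.commute)
    show ?thesis
      by (simp add: vec_eq_iff mixed_cov_def matrix_matrix_mult_def transpose_def sum_option_UNIV factor_cov_def
          pick pick' M_None)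
        (simp add: algebra_simps)
  qed
  moreover have "posdef_matrix (M ** factor_cov S ** transpose M)"
  proof (rule posdef_matrix_congruence[OF posdef_factor_cov[OF S]])
    fix x :: "real ^ 'g" assume "transpose M *v x = 0"
    then have *: "(\<Sum>h\<in>UNIV. M $ h $ k * x $ h) = 0" for k
      by (simp add: vec_eq_iff matrix_vector_mult_def transpose_def)
    have nz: "x $ a = 0" if "a \<noteq> g\<^sub>0" for a
      using *[of "Some a"] that p(1)[OF that]
      by (simp add: M_Some if_distrib[where f = "\<lambda>x. x * _"] cong: if_cong)
    have "(\<Sum>h\<in>UNIV. M $ h $ None * x $ h) = (\<Sum>h\<in>{g\<^sub>0}. M $ h $ None * x $ h)"
      by (rule sum.mono_neutral_right) (auto simp: nz)
    then have "x $ g\<^sub>0 = 0"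
      using *[of None] m by (simp add: M_None)
    with nz show "x = 0"
      by (metis vec_eq_iff zero_index)
  qed
  ultimately show ?thesis
    by simp
qed

section \<open>Testlets with few loadings\<close>

text \<open>
  In terms of the standardized loading \<open>f x = x / sqrt (1 + x\<^sup>2)\<close>, which increases
  strictly with \<open>x\<close>: the loading is raised from \<open>x\<close> to \<open>x'\<close>,
  \<open>c = f x / f x'\<close> is the factor by which all partners must be lowered in compensation,
  and \<open>l\<close> is the change of scale of the item.
\<close>

lemma communality_shift:
  fixes x :: real
  assumes x: "0 \<le> x"
  obtains l c x' where "0 < l" "0 \<le> c" "c < 1" "x < x'"
    "1 + x'\<^sup>2 = l\<^sup>2 * (1 + x\<^sup>2)" "c * x' = l * x"
proof
  \<comment> \<open>Any \<open>x' > x\<close> would do; \<open>l\<close> and \<open>c\<close> are then forced by the two equations.\<close>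
  let ?x' = "x + 1"
  let ?l = "sqrt ((1 + ?x'\<^sup>2) / (1 + x\<^sup>2))"
  have pos: "0 < 1 + x\<^sup>2" "0 < 1 + ?x'\<^sup>2"
    by (simp_all add: add_pos_nonneg)
  then have l2: "?l\<^sup>2 = (1 + ?x'\<^sup>2) / (1 + x\<^sup>2)"
    by simp
  show l: "0 < ?l"
    using pos by simp
  show "0 \<le> ?l * x / ?x'" "?l * x / ?x' * ?x' = ?l * x" "x < ?x'"
    using x l by simp_all
  show "1 + ?x'\<^sup>2 = ?l\<^sup>2 * (1 + x\<^sup>2)"
    unfolding l2 using pos by simp
  have "(?l * x)\<^sup>2 < ?x'\<^sup>2"
  proof -
    have "x\<^sup>2 < ?x'\<^sup>2"
      using x by (simp add: power_strict_mono)
    then have "(1 + ?x'\<^sup>2) * x\<^sup>2 < ?x'\<^sup>2 * (1 + x\<^sup>2)"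
      by (simp add: distrib_left distrib_right mult.commute)
    then show ?thesis
      unfolding power_mult_distrib l2 using pos by (simp add: pos_divide_less_eq)
  qed
  then have "?l * x < ?x'"
    by (rule power_less_imp_less_base) (use x in simp)
  then show "?l * x / ?x' < 1"
    using x by simp
qed

text \<open>
  The loading of the only item on the testlet factor can be raised if the correlations of that factor
  with the others are lowered in proportion. The added variance is indistinguishable from item noise
  after rescaling the item.
\<close>

lemma not_identifiable_if_testlet_has_one_loading:
  fixes testlet :: "'j::{finite,linorder} \<Rightarrow> 'g::finite"
  assumes \<theta>: "(A, d, S) \<in> param_space testlet"
    and j: "testlet j = g" and Q: "\<And>k. k \<noteq> j \<Longrightarrow> A $ k $ Some g = 0"
  shows "\<not> identifiable_at testlet (A, d, S)"
proof -
  note A = param_spaceD(1)[OF \<theta>] and S = param_spaceD(2)[OF \<theta>] and diag = param_spaceD(3)[OF \<theta>]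
  let ?x = "A $ j $ Some g"
  have "0 \<le> ?x"
    using param_spaceD(4)[OF \<theta>, of j "Some g"] Q by (cases "?x = 0") (auto simp: less_imp_le)
  then obtain l c x' where l: "0 < l" and c: "0 \<le> c" "c < 1" and x': "?x < x'"
    and var: "1 + x'\<^sup>2 = l\<^sup>2 * (1 + ?x\<^sup>2)" and cx': "c * x' = l * ?x"
    by (rule communality_shift)
  \<comment> \<open>The testlet factor becomes \<open>c\<close> times itself plus independent noise, and item \<open>j\<close> is rescaled by \<open>l\<close>.
    The old main factor, being uncorrelated with the testlet factors, stands in for that noise in the covariance.\<close>
  define L where "L k = (if k = j then l else 1)" for k
  define A' where "A' = ((\<chi> k r. if r = Some g then if k = j then x' else 0 else L k * A $ k $ r))"
  define d' where "d' = ((\<chi> k. L k * d $ k))"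
  define S' where "S' = mixed_cov g (\<lambda>h. if h = g then sqrt (1 - c\<^sup>2) else 0) (\<lambda>h. if h = g then 0 else 1) (\<lambda>h. if h = g then c else 0) S"
  have c2: "c\<^sup>2 < 1"
    using c by (simp add: power_less_one_iff abs_square_less_1)
  have L: "0 < L k" for k
    using l by (simp add: L_def)
  have S'_pd: "posdef_matrix S'"
    unfolding S'_def using c2 by (intro posdef_mixed_cov S) auto
  have S'_entry: "S' $ h $ k = (if h = g \<and> k = g then 1 else if h = g \<or> k = g then c * S $ h $ k else S $ h $ k)" for h k
    using c2 by (auto simp: S'_def mixed_cov_def diag power2_eq_square)
  have A'_zero: "A' $ k $ Some h = 0" if "h \<noteq> testlet k" for k h
    using A[OF that] that j by (auto simp: A'_def)
  have "(A', d', S') \<in> param_space testlet"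
  proof -
    have "0 < A' $ k $ r" if nz: "A' $ k $ r \<noteq> 0" and first: "\<forall>i<k. A' $ i $ r = 0" for k r
    proof (cases "r = Some g")
      case True
      then show ?thesis
        using nz x' \<open>0 \<le> ?x\<close> by (auto simp: A'_def split: if_splits)
    next
      case False
      have "A $ i $ r = 0" if "i < k" for i
        using first that False L[of i] by (auto simp: A'_def)
      then show ?thesis
        using nz False L[of k] param_spaceD(4)[OF \<theta>, of k r] by (auto simp: A'_def)
    qed
    then show ?thesis
      using A'_zero S'_pd by (auto simp: param_space_def S'_entry diag)
  qed
  moreover have "response_dist testlet (A', d', S') = response_dist testlet (A, d, S)"
  proof (rule response_dist_eqI[OF A S A'_zero S'_pd L])
    show "d' $ k = L k * d $ k" for k
      by (simp add: d'_def)
    fix i k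
    have A'_main: "A' $ i $ None = L i * A $ i $ None" for i
      by (simp add: A'_def)
    have A'_own: "A' $ i $ Some (testlet i) = (if i = j then x' else A $ i $ Some (testlet i))" for i
      using Q[of i] j by (auto simp: A'_def L_def)
    have cross: "x' * a * (c * s) = l * (?x * a * s)" "a * x' * (c * s) = l * (a * ?x * s)" for a s
      using cx' by algebra+
    have A'_g: "A' $ k $ Some g = (if k = j then x' else 0)" for k
      by (simp add: A'_def)
    have zero: "A $ i $ Some (testlet i) = 0" if "i \<noteq> j" "testlet i = g" for i
      using Q[of i] that by simp
    have "A' $ i $ Some (testlet i) * A' $ k $ Some (testlet k) * S' $ testlet i $ testlet k + (if i = k then 1 else 0) =
       L i * L k * (A $ i $ Some (testlet i) * A $ k $ Some (testlet k) * S $ testlet i $ testlet k + (if i = k then 1 else 0))"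
    proof (cases "i = j"; cases "k = j")
      assume "i = j" "k = j"
      then show ?thesis
        using var j by (simp add: A'_g S'_entry diag L_def power2_eq_square algebra_simps)
    next
      assume "i = j" "k \<noteq> j"
      then show ?thesis
        using zero[of k] j by (cases "testlet k = g") (simp_all add: A'_own A'_g S'_entry L_def cross)
    next
      assume "i \<noteq> j" "k = j"
      then show ?thesis
        using zero[of i] j by (cases "testlet i = g") (simp_all add: A'_own A'_g S'_entry L_def cross)
    next
      assume "i \<noteq> j" "k \<noteq> j"
      then show ?thesis
        using zero[of i] zero[of k] by (simp add: A'_own S'_entry L_def)
    qed
    note main = this
    have cov: "marginal_cov A S $ a $ b = (if a = b then 1 else 0) + A $ a $ None * A $ b $ None
        + A $ a $ Some (testlet a) * A $ b $ Some (testlet b) * S $ testlet a $ testlet b" for a b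
      by (rule marginal_cov_entry) (rule A)
    have cov': "marginal_cov A' S' $ a $ b = (if a = b then 1 else 0) + A' $ a $ None * A' $ b $ None
        + A' $ a $ Some (testlet a) * A' $ b $ Some (testlet b) * S' $ testlet a $ testlet b" for a b
      by (rule marginal_cov_entry) (rule A'_zero)
    show "marginal_cov A' S' $ i $ k = L i * L k * marginal_cov A S $ i $ k"
      using main unfolding cov cov' A'_main by (simp add: algebra_simps)
  qed
  moreover have "A' \<noteq> A"
  proof
    assume "A' = A"
    then have "A' $ j $ Some g = ?x"
      by simp
    then show False
      using x' by (simp add: A'_def)
  qed
  ultimately show ?thesis
    by (auto simp: identifiable_at_def)
qed

text \<open>
  Here the testlet factor affects only the correlation between items \<open>i\<close> and
  \<open>j\<close>, through the product of the two standardized loadings. One of them can be raised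
  while the other is lowered.
\<close>

lemma not_identifiable_if_uncorrelated_testlet_has_two_loadings:
  fixes testlet :: "'j::{finite,linorder} \<Rightarrow> 'g::finite"
  assumes \<theta>: "(A, d, S) \<in> param_space testlet"
    and ij: "i < j" and Q: "Q_set A g = {i, j}" and uncorr: "\<And>h. h \<noteq> g \<Longrightarrow> S $ g $ h = 0"
  shows "\<not> identifiable_at testlet (A, d, S)"
proof -
  note A = param_spaceD(1)[OF \<theta>] and S = param_spaceD(2)[OF \<theta>] and diag = param_spaceD(3)[OF \<theta>]
  let ?x = "A $ i $ Some g" and ?y = "A $ j $ Some g"
  have Q0: "A $ k $ Some g = 0" if "k \<noteq> i" "k \<noteq> j" for k
    using that Q by (auto simp: Q_set_def)
  have nz: "?x \<noteq> 0" "?y \<noteq> 0"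
    using Q by (auto simp: Q_set_def)
  have testlet: "testlet i = g" "testlet j = g"
    using nz A by metis+
  have x: "0 < ?x"
    using param_spaceD(4)[OF \<theta>, of i "Some g"] nz Q0 ij by force
  then have "0 \<le> ?x"
    by simp
  then obtain l c x' where l: "0 < l" and c: "0 \<le> c" "c < 1" and x': "?x < x'"
    and var: "1 + x'\<^sup>2 = l\<^sup>2 * (1 + ?x\<^sup>2)" and cx': "c * x' = l * ?x"
    by (rule communality_shift)
  \<comment> \<open>The scale of item \<open>j\<close> when its standardized loading \<open>?y / sqrt (1 + ?y\<^sup>2)\<close> is multiplied by \<open>c\<close>; this keeps
    the standardized loadings of \<open>i\<close> and \<open>j\<close> at the same product.\<close>
  define m where "m = 1 / sqrt (1 + ?y\<^sup>2 * (1 - c\<^sup>2))"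
  have c2: "c\<^sup>2 < 1"
    using c by (simp add: power_less_one_iff abs_square_less_1)
  then have m_pos: "0 < 1 + ?y\<^sup>2 * (1 - c\<^sup>2)"
    by (simp add: add_pos_nonneg)
  then have m: "0 < m" and m2: "m\<^sup>2 * (1 + ?y\<^sup>2 * (1 - c\<^sup>2)) = 1"
    by (simp_all add: m_def power_divide)
  have var_y: "1 + (c * m * ?y)\<^sup>2 = m\<^sup>2 * (1 + ?y\<^sup>2)"
    using m2 by (simp add: algebra_simps power_mult_distrib)
  have cross: "x' * (c * m * ?y) = l * m * (?x * ?y)"
    using cx' by algebra
  define L where "L k = (if k = i then l else if k = j then m else 1)" for k
  define A' where "A' = ((\<chi> k r. if r = Some g then if k = i then x' else if k = j then c * m * ?y else 0
      else L k * A $ k $ r))"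
  define d' where "d' = ((\<chi> k. L k * d $ k))"
  have L: "0 < L k" for k
    using l m by (simp add: L_def)
  have A'_zero: "A' $ k $ Some h = 0" if "h \<noteq> testlet k" for k h
    using A[OF that] that testlet by (auto simp: A'_def)
  have "(A', d', S) \<in> param_space testlet"
  proof -
    have "0 < A' $ k $ r" if nz': "A' $ k $ r \<noteq> 0" and first: "\<forall>i<k. A' $ i $ r = 0" for k r
    proof (cases "r = Some g")
      case True
      have "A' $ i $ r = x'"
        using True by (simp add: A'_def)
      moreover have "x' \<noteq> 0"
        using x x' by simp
      ultimately have "k \<noteq> j"
        using first ij by auto
      then show ?thesis
        using True nz' x x' by (auto simp: A'_def split: if_splits)
    next
      case False
      have "A $ i $ r = 0" if "i < k" for i
        using first that False L[of i] by (auto simp: A'_def)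
      then show ?thesis
        using nz' False L[of k] param_spaceD(4)[OF \<theta>, of k r] by (auto simp: A'_def)
    qed
    then show ?thesis
      using A'_zero S by (auto simp: param_space_def diag)
  qed
  moreover have "response_dist testlet (A', d', S) = response_dist testlet (A, d, S)"
  proof (rule response_dist_eqI[OF A S A'_zero S L])
    show "d' $ k = L k * d $ k" for k
      by (simp add: d'_def)
    fix a b
    let ?t = "\<lambda>k. A $ k $ Some (testlet k)" and ?t' = "\<lambda>k. A' $ k $ Some (testlet k)"
    have A'_main: "A' $ i $ None = L i * A $ i $ None" for i
      by (simp add: A'_def)
    have t'_other: "?t' k = ?t k" and L_other: "L k = 1" if "k \<noteq> i" "k \<noteq> j" for k
      using that Q0[of k] by (auto simp: A'_def L_def)
    have A'_ij: "A' $ i $ Some g = x'" "A' $ j $ Some g = c * m * ?y"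
      using ij by (auto simp: A'_def)
    have t'_ij: "?t' i = x'" "?t' j = c * m * ?y" "?t i = ?x" "?t j = ?y" "L i = l" "L j = m"
      using ij testlet by (auto simp: A'_def L_def)
    have S0: "S $ g $ h = 0" "S $ h $ g = 0" if "h \<noteq> g" for h
      using uncorr[OF that] posdef_matrix_symmetric[OF S, of h g] by auto
    have outside: "?t k * S $ g $ testlet k = 0" "?t k * S $ testlet k $ g = 0" if "k \<noteq> i" "k \<noteq> j" for k
      using S0[of "testlet k"] Q0[OF that] by (cases "testlet k = g"; simp)+
    have "?t' a * ?t' b * S $ testlet a $ testlet b + (if a = b then 1 else 0) =
       L a * L b * (?t a * ?t b * S $ testlet a $ testlet b + (if a = b then 1 else 0))"
    proof (cases "a = i \<or> a = j"; cases "b = i \<or> b = j")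
      have ii: "x' * x' * 1 + 1 = l * l * (?x * ?x * 1 + 1)" and jj: "c * m * ?y * (c * m * ?y) * 1 + 1 = m * m * (?y * ?y * 1 + 1)"
        and ij': "x' * (c * m * ?y) * 1 + 0 = l * m * (?x * ?y * 1 + 0)" and ji: "c * m * ?y * x' * 1 + 0 = m * l * (?y * ?x * 1 + 0)"
        using var var_y cross by algebra+
      assume "a = i \<or> a = j" "b = i \<or> b = j"
      moreover have "i \<noteq> j" "j \<noteq> i"
        using ij by auto
      ultimately show ?thesis
        by (elim disjE) (simp_all only: t'_ij A'_ij testlet diag if_True if_False refl ii jj ij' ji)
    next
      assume "a = i \<or> a = j" "\<not> (b = i \<or> b = j)"
      then show ?thesis
        using outside[of b] testlet by (auto simp: t'_ij A'_ij t'_other L_other)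
    next
      assume "\<not> (a = i \<or> a = j)" "b = i \<or> b = j"
      then show ?thesis
        using outside[of a] testlet by (auto simp: t'_ij A'_ij t'_other L_other)
    next
      assume "\<not> (a = i \<or> a = j)" "\<not> (b = i \<or> b = j)"
      then show ?thesis
        by (simp add: t'_other L_other)
    qed
    note main = this
    have cov: "marginal_cov A S $ a $ b = (if a = b then 1 else 0) + A $ a $ None * A $ b $ None
        + A $ a $ Some (testlet a) * A $ b $ Some (testlet b) * S $ testlet a $ testlet b" for a b
      by (rule marginal_cov_entry) (rule A)
    have cov': "marginal_cov A' S $ a $ b = (if a = b then 1 else 0) + A' $ a $ None * A' $ b $ None
        + A' $ a $ Some (testlet a) * A' $ b $ Some (testlet b) * S $ testlet a $ testlet b" for a b
      by (rule marginal_cov_entry) (rule A'_zero)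
    show "marginal_cov A' S $ a $ b = L a * L b * marginal_cov A S $ a $ b"
      using main unfolding cov cov' A'_main by (simp add: algebra_simps)
  qed
  moreover have "A' \<noteq> A"
  proof
    assume "A' = A"
    then have "A' $ i $ Some g = ?x"
      by simp
    then show False
      using x' by (simp add: A'_def)
  qed
  ultimately show ?thesis
    by (auto simp: identifiable_at_def)
qed

section \<open>Testlets with proportional loadings\<close>

text \<open>
  Rotate the main factor and the factor of \<open>g\<^sub>0\<close> in their plane. A testlet with
  proportional loadings sees only one linear combination
  \<open>\<eta>\<^sub>h + c h * \<eta>\<^sub>0\<close> of the factors; its component along the rotated
  main factor becomes the new main loading, and its normalized residual the new testlet factor. The
  residual is uncorrelated with the rotated main factor, as the model demands, and nondegenerate
  because the correlation \<open>S $ g\<^sub>0 $ h\<close> is less than 1 in absolute value.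
\<close>

lemma rotated_factors:
  fixes testlet :: "'j::{finite,linorder} \<Rightarrow> 'g::finite" and co s :: real
  assumes \<theta>: "(A, d, S) \<in> param_space testlet"
    and ratio: "\<And>j. testlet j \<noteq> g\<^sub>0 \<Longrightarrow> A $ j $ None = c (testlet j) * A $ j $ Some (testlet j)"
    and rot: "co\<^sup>2 + s\<^sup>2 = 1" "s \<noteq> 0"
  shows "\<exists>A' S'. (A', d, S') \<in> param_space testlet \<and>
     response_dist testlet (A', d, S') = response_dist testlet (A, d, S) \<and>
     (\<forall>j. testlet j = g\<^sub>0 \<longrightarrow> (A' $ j $ None)\<^sup>2 = (co * A $ j $ None + s * A $ j $ Some g\<^sub>0)\<^sup>2)"
proof -
  note A = param_spaceD(1)[OF \<theta>] and S = param_spaceD(2)[OF \<theta>] and diag = param_spaceD(3)[OF \<theta>]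
  have sym: "S $ h $ g\<^sub>0 = S $ g\<^sub>0 $ h" for h
    by (rule posdef_matrix_symmetric[OF S])
  \<comment> \<open>\<open>c' h\<close> is the loading of the old combination \<open>\<eta>\<^sub>h + c h * \<eta>\<^sub>0\<close> on the rotated main factor, and \<open>r h\<close> the standard
    deviation of what the rotated main factor leaves unexplained.\<close>
  define c' where "c' h = co * c h + s * S $ g\<^sub>0 $ h" for h
  define r where "r h = sqrt (1 + (c h)\<^sup>2 - (c' h)\<^sup>2)" for h
  have r: "0 < r h" "r h * r h = 1 + c h * c h - c' h * c' h" if "h \<noteq> g\<^sub>0" for h
  proof -
    have "(c h)\<^sup>2 + (S $ g\<^sub>0 $ h)\<^sup>2 - (c' h)\<^sup>2 = (s * c h - co * S $ g\<^sub>0 $ h)\<^sup>2"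
      unfolding c'_def using rot(1) by algebra
    moreover have "(S $ g\<^sub>0 $ h)\<^sup>2 < 1"
      using posdef_correlation_less_1[OF S diag] that by metis
    ultimately have "0 < 1 + (c h)\<^sup>2 - (c' h)\<^sup>2"
      using zero_le_power2[of "s * c h - co * S $ g\<^sub>0 $ h"] by linarith
    then show "0 < r h" "r h * r h = 1 + c h * c h - c' h * c' h"
      by (simp_all add: r_def power2_eq_square[symmetric])
  qed
  \<comment> \<open>The new factors in terms of the old main factor, the old factor of the same testlet, and the old factor
    of \<open>g\<^sub>0\<close>, in this order.\<close>
  define m where "m h = (if h = g\<^sub>0 then - s else (c h - c' h * co) / r h)" for h
  define p where "p h = (if h = g\<^sub>0 then 0 else 1 / r h)" for h
  define q where "q h = (if h = g\<^sub>0 then co else - c' h * s / r h)" for h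
  define S' where "S' = mixed_cov g\<^sub>0 m p q S"
  define A' where "A' = (\<chi> j k. if testlet j = g\<^sub>0
      then if k = None then co * A $ j $ None + s * A $ j $ Some g\<^sub>0
           else if k = Some g\<^sub>0 then - s * A $ j $ None + co * A $ j $ Some g\<^sub>0 else 0
      else if k = None then c' (testlet j) * A $ j $ Some (testlet j)
           else if k = Some (testlet j) then r (testlet j) * A $ j $ Some (testlet j) else 0)"
  have S'_pd: "posdef_matrix S'"
    unfolding S'_def by (rule posdef_mixed_cov[OF S]) (use r(1) rot in \<open>force simp: p_def m_def\<close>)+
  have S'_00: "S' $ g\<^sub>0 $ g\<^sub>0 = 1"
    using rot(1) by (simp add: S'_def mixed_cov_def m_def p_def q_def diag power2_eq_square algebra_simps)
  have S'_0: "r h * S' $ g\<^sub>0 $ h = co * S $ g\<^sub>0 $ h - s * c h" "r h * S' $ h $ g\<^sub>0 = co * S $ g\<^sub>0 $ h - s * c h"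
    if "h \<noteq> g\<^sub>0" for h
  proof -
    have "r h \<noteq> 0"
      using r(1)[OF that] by simp
    moreover have "S' $ g\<^sub>0 $ h = (- s * (c h - c' h * co) + co * S $ g\<^sub>0 $ h + co * (- c' h * s)) / r h"
      using that by (simp add: S'_def mixed_cov_def m_def p_def q_def diag add_divide_distrib diff_divide_distrib right_diff_distrib)
    ultimately have "r h * S' $ g\<^sub>0 $ h = - s * (c h - c' h * co) + co * S $ g\<^sub>0 $ h + co * (- c' h * s)"
      by simp
    then show *: "r h * S' $ g\<^sub>0 $ h = co * S $ g\<^sub>0 $ h - s * c h"
      by (simp add: algebra_simps)
    show "r h * S' $ h $ g\<^sub>0 = co * S $ g\<^sub>0 $ h - s * c h"
      using * posdef_matrix_symmetric[OF S'_pd] by metis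
  qed
  have S'_rr: "r h * r k * S' $ h $ k = S $ h $ k + c h * c k - c' h * c' k" if "h \<noteq> g\<^sub>0" "k \<noteq> g\<^sub>0" for h k
  proof -
    have nz: "r h \<noteq> 0" "r k \<noteq> 0"
      using r(1)[OF that(1)] r(1)[OF that(2)] by simp_all
    have "S' $ h $ k = (c h - c' h * co) / r h * ((c k - c' k * co) / r k) + 1 / r h * (1 / r k) * S $ h $ k
        + 1 / r h * (- c' k * s / r k) * S $ g\<^sub>0 $ h + - c' h * s / r h * (1 / r k) * S $ g\<^sub>0 $ k + - c' h * s / r h * (- c' k * s / r k)"
      using that by (simp add: S'_def mixed_cov_def m_def p_def q_def diag sym mult.commute[of "r k" "r h"])
    also have "\<dots> = ((c h - c' h * co) * (c k - c' k * co) + S $ h $ k - c' k * s * S $ g\<^sub>0 $ h - c' h * s * S $ g\<^sub>0 $ k + c' h * c' k * s\<^sup>2) / (r h * r k)"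
      using nz by (simp add: field_simps power2_eq_square)
    finally have "r h * r k * S' $ h $ k = (c h - c' h * co) * (c k - c' k * co) + S $ h $ k - c' k * s * S $ g\<^sub>0 $ h - c' h * s * S $ g\<^sub>0 $ k + c' h * c' k * s\<^sup>2"
      using nz by simp
    also have "\<dots> = S $ h $ k + c h * c k - c' h * c' k"
      unfolding c'_def using rot(1) by algebra
    finally show ?thesis .
  qed
  have S'_diag: "S' $ h $ h = 1" for h
  proof (cases "h = g\<^sub>0")
    case False
    have "r h * r h * S' $ h $ h = r h * r h"
      using S'_rr[OF False False] r(2)[OF False] by (simp add: diag)
    then show ?thesis
      using r(1)[OF False] by simp
  qed (simp add: S'_00)
  have A'_zero: "A' $ j $ Some h = 0" if "h \<noteq> testlet j" for j h
    using that by (auto simp: A'_def)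
  have dist: "response_dist testlet (A', d, S') = response_dist testlet (A, d, S)"
  proof (rule response_dist_eqI[OF A S A'_zero S'_pd, where l = "\<lambda>_. 1"])
    fix j k
    have cov: "marginal_cov A S $ a $ b = (if a = b then 1 else 0) + A $ a $ None * A $ b $ None
        + A $ a $ Some (testlet a) * A $ b $ Some (testlet b) * S $ testlet a $ testlet b" for a b
      by (rule marginal_cov_entry) (rule A)
    have cov': "marginal_cov A' S' $ a $ b = (if a = b then 1 else 0) + A' $ a $ None * A' $ b $ None
        + A' $ a $ Some (testlet a) * A' $ b $ Some (testlet b) * S' $ testlet a $ testlet b" for a b
      by (rule marginal_cov_entry) (rule A'_zero)
    have in_g0: "A' $ a $ None = co * A $ a $ None + s * A $ a $ Some g\<^sub>0"
        "A' $ a $ Some (testlet a) = - s * A $ a $ None + co * A $ a $ Some g\<^sub>0" if "testlet a = g\<^sub>0" for a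
      using that by (simp_all add: A'_def)
    have out_g0: "A' $ a $ None = c' (testlet a) * A $ a $ Some (testlet a)"
        "A' $ a $ Some (testlet a) = r (testlet a) * A $ a $ Some (testlet a)" if "testlet a \<noteq> g\<^sub>0" for a
      using that by (simp_all add: A'_def)
    have "A' $ j $ None * A' $ k $ None + A' $ j $ Some (testlet j) * A' $ k $ Some (testlet k) * S' $ testlet j $ testlet k =
        A $ j $ None * A $ k $ None + A $ j $ Some (testlet j) * A $ k $ Some (testlet k) * S $ testlet j $ testlet k"
    proof (cases "testlet j = g\<^sub>0"; cases "testlet k = g\<^sub>0")
      assume jk: "testlet j = g\<^sub>0" "testlet k = g\<^sub>0"
      show ?thesis
        unfolding in_g0[OF jk(1)] in_g0[OF jk(2)] unfolding jk S'_00 diag using rot(1) by algebra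
    next
      assume jk: "testlet j = g\<^sub>0" "testlet k \<noteq> g\<^sub>0"
      show ?thesis
        unfolding in_g0[OF jk(1)] out_g0[OF jk(2)] ratio[OF jk(2)] unfolding jk(1)
        using rot(1) S'_0(1)[OF jk(2)] unfolding c'_def by algebra
    next
      assume jk: "testlet j \<noteq> g\<^sub>0" "testlet k = g\<^sub>0"
      show ?thesis
        unfolding in_g0[OF jk(2)] out_g0[OF jk(1)] ratio[OF jk(1)] unfolding jk(2) sym
        using rot(1) S'_0(2)[OF jk(1)] unfolding c'_def by algebra
    next
      assume jk: "testlet j \<noteq> g\<^sub>0" "testlet k \<noteq> g\<^sub>0"
      show ?thesis
        unfolding out_g0[OF jk(1)] out_g0[OF jk(2)] ratio[OF jk(1)] ratio[OF jk(2)]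
        using S'_rr[OF jk] by algebra
    qed
    then show "marginal_cov A' S' $ j $ k = 1 * 1 * marginal_cov A S $ j $ k"
      unfolding cov cov' by simp
  qed simp_all
  obtain A'' S'' where *: "(A'', d, S'') \<in> param_space testlet"
    "response_dist testlet (A'', d, S'') = response_dist testlet (A', d, S')"
    "\<And>j k. (A'' $ j $ k)\<^sup>2 = (A' $ j $ k)\<^sup>2"
    using exists_sign_normalized[of testlet A' S' d] A'_zero S'_pd S'_diag by blast
  have "(A'' $ j $ None)\<^sup>2 = (co * A $ j $ None + s * A $ j $ Some g\<^sub>0)\<^sup>2" if "testlet j = g\<^sub>0" for j
    using that by (simp add: *(3)) (simp add: A'_def)
  with * dist show ?thesis
    by metis
qed

text \<open>
  The rotation is visible in the squared main loading of an item that loads on the factor of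
  \<open>g\<^sub>0\<close>; squares are compared because the sign convention may flip columns.
\<close>

lemma not_identifiable_if_proportional_outside_one_testlet:
  fixes testlet :: "'j::{finite,linorder} \<Rightarrow> 'g::finite"
  assumes \<theta>: "(A, d, S) \<in> param_space testlet"
    and ratio: "\<And>j. testlet j \<noteq> g\<^sub>0 \<Longrightarrow> A $ j $ None = c (testlet j) * A $ j $ Some (testlet j)"
    and i: "A $ i $ Some g\<^sub>0 \<noteq> 0"
  shows "\<not> identifiable_at testlet (A, d, S)"
proof
  assume ident: "identifiable_at testlet (A, d, S)"
  let ?x = "A $ i $ None" and ?y = "A $ i $ Some g\<^sub>0"
  have "testlet i = g\<^sub>0"
    using i param_spaceD(1)[OF \<theta>] by metis
  then have *: "?x\<^sup>2 = (co * ?x + s * ?y)\<^sup>2" if "co\<^sup>2 + s\<^sup>2 = 1" "s \<noteq> 0" for co s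
    using rotated_factors[of A d S testlet g\<^sub>0 c co s] \<theta> ratio that ident
    unfolding identifiable_at_def by (metis prod.inject)
  \<comment> \<open>One rotation can leave \<open>?x\<^sup>2\<close> unchanged, but a rotation and its inverse cannot both do so unless \<open>?y = 0\<close>.\<close>
  have "?x\<^sup>2 = (3/5 * ?x + 4/5 * ?y)\<^sup>2" "?x\<^sup>2 = (3/5 * ?x + (- 4/5) * ?y)\<^sup>2"
    by (rule *; simp add: power2_eq_square)+
  moreover have "(3/5 * ?x + 4/5 * ?y)\<^sup>2 = 9/25 * ?x\<^sup>2 + 24/25 * (?x * ?y) + 16/25 * ?y\<^sup>2"
    "(3/5 * ?x + (- 4/5) * ?y)\<^sup>2 = 9/25 * ?x\<^sup>2 - 24/25 * (?x * ?y) + 16/25 * ?y\<^sup>2"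
    by (simp_all add: power2_eq_square algebra_simps)
  ultimately have "?x * ?y = 0" "?y\<^sup>2 = ?x\<^sup>2"
    by linarith+
  with i show False
    by auto
qed

text \<open>
  A nonzero kernel vector has a nonzero first entry, for otherwise the testlet loadings would vanish.
\<close>

lemma proportional_if_rank_ne_2:
  assumes rank: "h \<notin> H3_set testlet A" and i: "testlet i = h" "A $ i $ Some h \<noteq> 0"
  shows "\<exists>c. \<forall>j. testlet j = h \<longrightarrow> A $ j $ None = c * A $ j $ Some h"
proof -
  let ?T = "testlet_loadings testlet A h"
  have "\<not> inj ((*v) ?T)"
    using rank full_rank_injective[of ?T] by (simp add: H3_set_def)
  then obtain x where x: "x \<noteq> 0" "?T *v x = 0"
    using matrix_left_invertible_ker[of ?T] matrix_left_invertible_injective[of ?T] by auto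
  have eq: "A $ j $ None * x $ 1 + A $ j $ Some h * x $ 2 = 0" if "testlet j = h" for j
  proof -
    have "(?T *v x) $ j = 0"
      using x(2) by simp
    then show ?thesis
      using that by (simp add: matrix_vector_mult_def testlet_loadings_def sum_2)
  qed
  have "x $ 1 \<noteq> 0"
  proof
    assume "x $ 1 = 0"
    moreover from this have "x $ 2 = 0"
      using eq[OF i(1)] i(2) by simp
    ultimately show False
      using x(1) by (simp add: vec_eq_iff forall_2)
  qed
  then have "A $ j $ None = - x $ 2 / x $ 1 * A $ j $ Some h" if "testlet j = h" for j
    using eq[OF that] by (simp add: field_simps)
  then show ?thesis
    by blast
qed

section \<open>Necessary conditions for identifiability\<close>

theorem theorem8:
  fixes testlet :: "'j::{finite,linorder} \<Rightarrow> 'g::finite"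
    and A :: "real ^ ('g option) ^ 'j::{finite,linorder}"
    and d :: "real ^ 'j::{finite,linorder}"
    and S :: "real ^ 'g ^ 'g"
  assumes "surj testlet"
    and "(A, d, S) \<in> param_space testlet"
    and "identifiable_at testlet (A, d, S)"
  shows "((\<forall>g. card (Q_set A g) \<ge> 2) \<and>
          (\<forall>g. (\<forall>h. h \<noteq> g \<longrightarrow> S $ g $ h = 0) \<longrightarrow> card (Q_set A g) \<ge> 3)) \<and>
         card (H3_set testlet A) \<ge> 2"
proof -
  note \<theta> = assms(2) and ident = assms(3)
  note A = param_spaceD(1)[OF \<theta>]
  have two: "card (Q_set A g) \<ge> 2" for g
  proof (rule ccontr)
    assume "\<not> card (Q_set A g) \<ge> 2"
    then have "card (Q_set A g) = 0 \<or> card (Q_set A g) = 1"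
      by linarith
    then obtain j where "testlet j = g" "\<And>k. k \<noteq> j \<Longrightarrow> A $ k $ Some g = 0"
    proof
      assume "card (Q_set A g) = 0"
      then have "A $ k $ Some g = 0" for k
        by (simp add: Q_set_def)
      moreover obtain j where "testlet j = g"
        using \<open>surj testlet\<close> by (metis surjD)
      ultimately show thesis
        using that by blast
    next
      assume "card (Q_set A g) = 1"
      then obtain j where Q: "Q_set A g = {j}"
        by (rule card_1_singletonE)
      then have "A $ j $ Some g \<noteq> 0" "\<And>k. k \<noteq> j \<Longrightarrow> A $ k $ Some g = 0"
        by (auto simp: Q_set_def)
      moreover from this have "testlet j = g"
        using A by metis
      ultimately show thesis
        using that by blast
    qed
    then show False
      using not_identifiable_if_testlet_has_one_loading[OF \<theta>] ident by blast
  qed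
  have three: "card (Q_set A g) \<ge> 3" if uncorr: "\<forall>h. h \<noteq> g \<longrightarrow> S $ g $ h = 0" for g
  proof (rule ccontr)
    assume "\<not> card (Q_set A g) \<ge> 3"
    then have "card (Q_set A g) = 2"
      using two[of g] by linarith
    then obtain i j where "Q_set A g = {i, j}" "i \<noteq> j"
      by (auto simp: card_2_iff)
    then obtain i j where "Q_set A g = {i, j}" "i < j"
      by (metis insert_commute linorder_neqE)
    then show False
      using not_identifiable_if_uncorrelated_testlet_has_two_loadings[OF \<theta>] uncorr ident by blast
  qed
  have "card (H3_set testlet A) \<ge> 2"
  proof (rule ccontr)
    assume "\<not> card (H3_set testlet A) \<ge> 2"
    then have "card (H3_set testlet A) = 0 \<or> card (H3_set testlet A) = 1"
      by linarith
    then obtain g\<^sub>0 where H3: "H3_set testlet A \<subseteq> {g\<^sub>0}"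
      by (metis card_0_eq card_1_singletonE empty_subsetI finite subset_refl)
    have load: "\<exists>i. testlet i = h \<and> A $ i $ Some h \<noteq> 0" for h
    proof -
      have "Q_set A h \<noteq> {}"
        using two[of h] by auto
      then obtain i where "A $ i $ Some h \<noteq> 0"
        by (auto simp: Q_set_def)
      then show ?thesis
        using A by metis
    qed
    have "\<exists>c. \<forall>j. testlet j = h \<longrightarrow> A $ j $ None = c * A $ j $ Some h" if "h \<noteq> g\<^sub>0" for h
      using proportional_if_rank_ne_2[of h testlet A] load[of h] H3 that by blast
    then obtain c where "\<And>h j. h \<noteq> g\<^sub>0 \<Longrightarrow> testlet j = h \<Longrightarrow> A $ j $ None = c h * A $ j $ Some h"
      by metis
    moreover obtain i where "A $ i $ Some g\<^sub>0 \<noteq> 0"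
      using load[of g\<^sub>0] by blast
    ultimately show False
      using not_identifiable_if_proportional_outside_one_testlet[OF \<theta>, of g\<^sub>0 c i] ident by blast
  qed
  with two three show ?thesis
    by blast
qed

end
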